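(* Assume that $f:(0,+\infty)\to\mathbb{R}$ is a nonincreasing positive locally Lipschitz continuous function. Consider the problem $$-\Delta u=f(u)\ \text{ in }\mathbb{R}^N_+,\qquad u>0\ \text{ in }\mathbb{R}^N_+,\qquad u=0\ \text{ on }\partial\mathbb{R}^N_+.\tag{P}$$ Let $u\in C^2(\mathbb{R}^N_+)\cap C(\overline{\mathbb{R}^N_+})$ be a solution to (P). Then $u$ depends only on $x_N$. Consequently, a solution of (P) in $C^2(\mathbb{R}^N_+)\cap C(\overline{\mathbb{R}^N_+})$ exists if and only if $\int_1^{+\infty}f(t)\,dt<+\infty$. Moreover, when such a solution exists, it is given by $u(x)\equiv v(x_N)$, where $v$ is determined by the formula $$\int_0^{v(t)}\frac{ds}{\sqrt{M+F(s)}}=\sqrt2\,t\quad\text{for all }t\ge0$$ for some $M\ge0$, where $F(s)=\int_s^{+\infty}f(t)\,dt$.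
   Context: $N$ is a positive integer (the space dimension). Points of $\mathbb{R}^N$ are written $x=(x',x_N)$ with $x'\in\mathbb{R}^{N-1}$, $x_N\in\mathbb{R}$, and $\mathbb{R}^N_+:=\{(x',x_N)\in\mathbb{R}^N\mid x_N>0\}$. The equation is understood in the classical sense in the interior of the domain. *)

theory Defs
  imports "HOL-Analysis.Analysis"
begin

text \<open>
  Points of \<open>N\<close>-space are vectors of type \<open>real ^ 'n\<close> with \<open>N = CARD('n)\<close>; since \<open>'n\<close> carries no
  order, the index of the coordinate \<open>x\<^sub>N\<close> is an explicit parameter \<open>k :: 'n\<close>.
\<close>

definition half_space :: "'n::finite \<Rightarrow> (real ^ 'n) set" where
  "half_space k = {x. x $ k > 0}"

definition partial_derivative :: "'n::finite \<Rightarrow> (real ^ 'n \<Rightarrow> real) \<Rightarrow> real ^ 'n \<Rightarrow> real" where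
  "partial_derivative i u x = frechet_derivative u (at x) (axis i 1)"

definition laplacian :: "(real ^ 'n::finite \<Rightarrow> real) \<Rightarrow> real ^ 'n \<Rightarrow> real" where
  "laplacian u x = (\<Sum>i\<in>UNIV. partial_derivative i (partial_derivative i u) x)"

text \<open>
  The next two definitions are meant for open sets \<open>S\<close> only. Derivatives are then taken at interior
  points, so the values of \<open>u\<close> outside \<open>S\<close> do not matter.
\<close>

definition C1_on :: "(real ^ 'n::finite) set \<Rightarrow> (real ^ 'n \<Rightarrow> real) \<Rightarrow> bool" where
  "C1_on S u \<longleftrightarrow> (\<forall>x\<in>S. u differentiable (at x)) \<and> (\<forall>i. continuous_on S (partial_derivative i u))"

definition C2_on :: "(real ^ 'n::finite) set \<Rightarrow> (real ^ 'n \<Rightarrow> real) \<Rightarrow> bool" where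
  "C2_on S u \<longleftrightarrow> C1_on S u \<and> (\<forall>i. C1_on S (partial_derivative i u))"

definition locally_lipschitz_on :: "real set \<Rightarrow> (real \<Rightarrow> real) \<Rightarrow> bool" where
  "locally_lipschitz_on S f \<longleftrightarrow> (\<forall>x\<in>S. \<exists>e>0. \<exists>L. L-lipschitz_on (ball x e \<inter> S) f)"

text \<open>
  Only the restriction of \<open>u\<close> to the closed half-space is constrained.
\<close>

definition is_solution :: "(real \<Rightarrow> real) \<Rightarrow> 'n::finite \<Rightarrow> (real ^ 'n \<Rightarrow> real) \<Rightarrow> bool" where
  "is_solution f k u \<longleftrightarrow>
     C2_on (half_space k) u \<and>
     continuous_on (closure (half_space k)) u \<and>
     (\<forall>x\<in>half_space k. - laplacian u x = f (u x)) \<and>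
     (\<forall>x\<in>half_space k. u x > 0) \<and>
     (\<forall>x\<in>frontier (half_space k). u x = 0)"

text \<open>
  The tail integral is only used when \<open>f\<close> is integrable near \<open>\<infinity>\<close>. Interval integrals range over the
  open interval, so neither \<open>f\<close> nor \<open>tail_integral f\<close> is evaluated at 0 below, although the
  latter may tend to \<open>\<infinity>\<close> there.
\<close>

definition tail_integral :: "(real \<Rightarrow> real) \<Rightarrow> real \<Rightarrow> real" where
  "tail_integral f s = (LBINT t=ereal s..\<infinity>. f t)"

text \<open>
  ``\<open>v\<close> is determined by the formula'': for each \<open>t \<ge> 0\<close>, \<open>v t\<close> is the one nonnegative number that
  satisfies it.
\<close>

definition determined_by_formula :: "(real \<Rightarrow> real) \<Rightarrow> real \<Rightarrow> (real \<Rightarrow> real) \<Rightarrow> bool" where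
  "determined_by_formula f M v \<longleftrightarrow>
     (\<forall>t\<ge>0. v t \<ge> 0 \<and>
        (\<forall>y\<ge>0. (LBINT s=ereal 0..ereal y. 1 / sqrt (M + tail_integral f s)) = sqrt 2 * t \<longleftrightarrow> y = v t))"

end

(*
  Let c be the infimum of u(x) / x_N. The one-dimensional solution v with slope c at infinity lies below
  u: since f is nonincreasing, v - u is subharmonic where it is positive, and it is at most
  v - c x_N = o(x_N), so the Phragmen-Lindelof principle applies. Now p = u - v is nonnegative,
  subharmonic and zero on the boundary, and it is dominated by the superharmonic function
  P = u - c x_N, for which the infimum of P / x_N is 0. If p were positive somewhere, Harnack's
  inequality for the pair p <= P and boundary barriers would give P >= c' x_N with c' > 0. Hence u = v.
*)
theory Submission
  imports Defs
begin

section \<open>Twice continuously differentiable functions\<close>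

text \<open>Nothing bounds \<open>u\<close> from above, so \<open>p = u - v\<close> is out of reach
  of Phragmen-Lindelof; its only control is \<open>p \<le> P\<close>, with \<open>P\<close> small
  relative to \<open>x $ k\<close> at some points. Hence a Harnack inequality for a pair:
  \<open>p\<close> is merely subharmonic and \<open>P\<close> merely superharmonic, so neither
  satisfies the classical two-sided inequality, but one mean value inequality for each, joined by
  \<open>p \<le> P\<close>, is enough. Only signs of Laplacians and continuity up to the boundary
  enter, because \<open>f\<close>, and with it the derivatives of \<open>u\<close>, may blow up
  there.

  The profile \<open>v\<close> exists only if \<open>f\<close> is integrable at infinity, which is
  itself part of the claim. It is obtained beforehand by comparing \<open>u\<close> with profiles of
  integrable minorants of \<open>f\<close>.

  All barriers are built from \<open>|x - a|^(-2 d)\<close>, where \<open>d\<close> is the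
  dimension. Unlike the fundamental solution, this is one formula for every dimension, 1 and 2
  included, and its Laplacian is strictly positive.\<close>

lemma partial_derivative_eqI:
  fixes u :: "real ^ 'n::finite \<Rightarrow> real"
  assumes "(u has_derivative u') (at x)"
  shows "partial_derivative i u x = u' (axis i 1)"
  using frechet_derivative_at[OF assms] by (simp add: partial_derivative_def)

lemma sum_mult_axis: "(\<Sum>j\<in>UNIV. c j * (axis i 1 :: real ^ 'n::finite) $ j) = c i"
proof -
  have "(\<Sum>j\<in>UNIV. c j * (axis i 1 :: real ^ 'n) $ j) = (\<Sum>j\<in>UNIV. if j = i then c j else 0)"
    by (rule sum.cong) (auto simp: axis_def)
  then show ?thesis by simp
qed

lemma C1_on_has_derivative:
  fixes u :: "real ^ 'n::finite \<Rightarrow> real"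
  assumes "C1_on S u" "x \<in> S"
  shows "(u has_derivative (\<lambda>h. \<Sum>i\<in>UNIV. partial_derivative i u x * h $ i)) (at x)"
proof -
  have d: "u differentiable (at x)" using assms by (auto simp: C1_on_def)
  then have D: "(u has_derivative frechet_derivative u (at x)) (at x)"
    by (simp add: frechet_derivative_works)
  have lin: "linear (frechet_derivative u (at x))"
    using D has_derivative_bounded_linear bounded_linear.linear by blast
  have "frechet_derivative u (at x) h = (\<Sum>i\<in>UNIV. partial_derivative i u x * h $ i)" for h
  proof -
    have "frechet_derivative u (at x) h = frechet_derivative u (at x) (\<Sum>i\<in>UNIV. h $ i *\<^sub>R axis i 1)"
      using basis_expansion[of h] by (simp add: scalar_mult_eq_scaleR)
    also have "\<dots> = (\<Sum>i\<in>UNIV. h $ i *\<^sub>R frechet_derivative u (at x) (axis i 1))"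
      by (simp add: linear_sum[OF lin] linear_cmul[OF lin])
    finally show ?thesis by (simp add: partial_derivative_def mult.commute)
  qed
  then show ?thesis using D by (metis (no_types, lifting) ext)
qed

lemma C1_onI:
  fixes u :: "real ^ 'n::finite \<Rightarrow> real"
  assumes "\<And>x. x \<in> S \<Longrightarrow> (u has_derivative (\<lambda>h. \<Sum>i\<in>UNIV. D i x * h $ i)) (at x)"
    and "\<And>i. continuous_on S (D i)"
  shows "C1_on S u" and "\<And>i x. x \<in> S \<Longrightarrow> partial_derivative i u x = D i x"
proof -
  show *: "\<And>i x. x \<in> S \<Longrightarrow> partial_derivative i u x = D i x"
    using partial_derivative_eqI[OF assms(1)] sum_mult_axis[of "\<lambda>j. D j _"] by metis
  show "C1_on S u"
    unfolding C1_on_def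
  proof (intro conjI ballI allI)
    show "u differentiable at x" if "x \<in> S" for x
      using assms(1)[OF that] unfolding differentiable_def by blast
    show "continuous_on S (partial_derivative i u)" for i
      using assms(2)[of i] * by (simp cong: continuous_on_cong)
  qed
qed

text \<open>\<open>partial_derivative i u\<close> is a total function that agrees with a computed
  formula only on \<open>S\<close>. Openness of \<open>S\<close> allows the formula to be
  differentiated in its place, as second derivatives require.\<close>

lemma C1_on_cong:
  fixes u w :: "real ^ 'n::finite \<Rightarrow> real"
  assumes "open S" "C1_on S u" "\<And>x. x \<in> S \<Longrightarrow> w x = u x"
  shows "C1_on S w" and "\<And>i x. x \<in> S \<Longrightarrow> partial_derivative i w x = partial_derivative i u x"
proof -
  have "(w has_derivative (\<lambda>h. \<Sum>i\<in>UNIV. partial_derivative i u x * h $ i)) (at x)" if "x \<in> S" for x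
    using has_derivative_transform_within_open[OF C1_on_has_derivative[OF assms(2) that] assms(1) that]
      assms(3) by auto
  from C1_onI[OF this] assms(2)
  show "C1_on S w" "\<And>i x. x \<in> S \<Longrightarrow> partial_derivative i w x = partial_derivative i u x"
    unfolding C1_on_def by auto
qed

lemma C2_onI:
  fixes u :: "real ^ 'n::finite \<Rightarrow> real"
  assumes S: "open S"
    and u: "\<And>x. x \<in> S \<Longrightarrow> (u has_derivative (\<lambda>h. \<Sum>i\<in>UNIV. D i x * h $ i)) (at x)"
    and D: "\<And>i x. x \<in> S \<Longrightarrow> (D i has_derivative (\<lambda>h. \<Sum>j\<in>UNIV. E i j x * h $ j)) (at x)"
    and E: "\<And>i j. continuous_on S (E i j)"
  shows "C2_on S u" and "\<And>x. x \<in> S \<Longrightarrow> laplacian u x = (\<Sum>i\<in>UNIV. E i i x)"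
proof -
  have D1: "C1_on S (D i)" "\<And>j x. x \<in> S \<Longrightarrow> partial_derivative j (D i) x = E i j x" for i
    using C1_onI[of S "D i" "E i", OF D E] by auto
  have "continuous_on S (D i)" for i
    using D by (meson continuous_at_imp_continuous_on has_derivative_continuous)
  note u1 = C1_onI[of S u D, OF u this]
  note D2 = C1_on_cong[OF S D1(1) u1(2)]
  show "C2_on S u" unfolding C2_on_def using u1(1) D2(1) by blast
  show "\<And>x. x \<in> S \<Longrightarrow> laplacian u x = (\<Sum>i\<in>UNIV. E i i x)"
    unfolding laplacian_def by (rule sum.cong) (auto simp: D2(2) D1(2))
qed

lemma C2_on_derivs:
  fixes u :: "real ^ 'n::finite \<Rightarrow> real"
  assumes "C2_on S u"
  shows "x \<in> S \<Longrightarrow> (u has_derivative (\<lambda>h. \<Sum>i\<in>UNIV. partial_derivative i u x * h $ i)) (at x)"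
    and "x \<in> S \<Longrightarrow> (partial_derivative i u has_derivative
          (\<lambda>h. \<Sum>j\<in>UNIV. partial_derivative j (partial_derivative i u) x * h $ j)) (at x)"
    and "continuous_on S (partial_derivative i u)"
    and "continuous_on S (partial_derivative j (partial_derivative i u))"
  using assms C1_on_has_derivative[of S] unfolding C2_on_def by (auto simp: C1_on_def)

text \<open>Sums, differences and constant shifts all go through this one form. Later functions
  therefore carry explicit factors such as \<open>1 *\<close> and \<open>(- 1) *\<close>, so that
  instances fold into their definitions.\<close>

lemma C2_on_lincomb:
  fixes u w :: "real ^ 'n::finite \<Rightarrow> real"
  assumes S: "open S" and u: "C2_on S u" and w: "C2_on S w"
  shows "C2_on S (\<lambda>x. a * u x + b * w x)"
    and "\<And>x. x \<in> S \<Longrightarrow> laplacian (\<lambda>x. a * u x + b * w x) x = a * laplacian u x + b * laplacian w x"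
proof -
  let ?D = "\<lambda>i x. a * partial_derivative i u x + b * partial_derivative i w x"
  let ?E = "\<lambda>i j x. a * partial_derivative j (partial_derivative i u) x
      + b * partial_derivative j (partial_derivative i w) x"
  have 1: "((\<lambda>x. a * u x + b * w x) has_derivative (\<lambda>h. \<Sum>i\<in>UNIV. ?D i x * h $ i)) (at x)"
    if "x \<in> S" for x
    using has_derivative_add[OF has_derivative_mult_right[OF C2_on_derivs(1)[OF u that], of a]
        has_derivative_mult_right[OF C2_on_derivs(1)[OF w that], of b]]
    by (simp add: sum_distrib_left sum.distrib algebra_simps)
  have 2: "(?D i has_derivative (\<lambda>h. \<Sum>j\<in>UNIV. ?E i j x * h $ j)) (at x)"
    if "x \<in> S" for x i
    using has_derivative_add[OF has_derivative_mult_right[OF C2_on_derivs(2)[OF u that], of a i]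
        has_derivative_mult_right[OF C2_on_derivs(2)[OF w that], of b i]]
    by (simp add: sum_distrib_left sum.distrib algebra_simps)
  have 3: "continuous_on S (?E i j)" for i j
    using C2_on_derivs(4)[OF u] C2_on_derivs(4)[OF w] by (intro continuous_intros)
  show "C2_on S (\<lambda>x. a * u x + b * w x)"
    by (rule C2_onI(1)[OF S, where D = ?D and E = ?E]) (use 1 2 3 in auto)
  show "laplacian (\<lambda>x. a * u x + b * w x) x = a * laplacian u x + b * laplacian w x"
    if "x \<in> S" for x
  proof -
    have "laplacian (\<lambda>x. a * u x + b * w x) x = (\<Sum>i\<in>UNIV. ?E i i x)"
      by (rule C2_onI(2)[OF S, where D = ?D and E = ?E]) (use 1 2 3 that in auto)
    then show ?thesis by (simp add: laplacian_def sum_distrib_left sum.distrib)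
  qed
qed

lemma C2_on_const:
  fixes S :: "(real ^ 'n::finite) set"
  assumes "open S"
  shows "C2_on S (\<lambda>_. c)" and "\<And>x. x \<in> S \<Longrightarrow> laplacian (\<lambda>_. c) x = 0"
  using C2_onI[OF assms, of "\<lambda>_. c" "\<lambda>_ _. 0" "\<lambda>_ _ _. 0"] by auto

lemma C2_on_subset: "C2_on S u \<Longrightarrow> T \<subseteq> S \<Longrightarrow> C2_on T u"
  unfolding C2_on_def C1_on_def using continuous_on_subset by (metis subsetD)

lemma C2_on_coordinate:
  fixes k :: "'n::finite" and h h' h'' :: "real \<Rightarrow> real"
  assumes S: "open S"
    and h: "\<And>x. x \<in> S \<Longrightarrow> (h has_real_derivative h' (x $ k)) (at (x $ k))"
    and h': "\<And>x. x \<in> S \<Longrightarrow> (h' has_real_derivative h'' (x $ k)) (at (x $ k))"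
    and h'': "continuous_on S (\<lambda>x. h'' (x $ k))"
  shows "C2_on S (\<lambda>x. h (x $ k))"
    and "\<And>x. x \<in> S \<Longrightarrow> laplacian (\<lambda>x. h (x $ k)) x = h'' (x $ k)"
proof -
  have *: "((\<lambda>x. g (x $ k)) has_derivative (\<lambda>y. \<Sum>i\<in>UNIV. (if i = k then g' (x $ k) else 0) * y $ i)) (at x)"
    if "(g has_real_derivative g' (x $ k)) (at (x $ k))" for g g' and x :: "real ^ 'n"
  proof -
    have "(\<Sum>i\<in>UNIV. (if i = k then g' (x $ k) else 0) * y $ i) = g' (x $ k) * y $ k" for y :: "real ^ 'n"
      by (subst sum.cong[OF refl, of _ _ "\<lambda>i. if i = k then g' (x $ k) * y $ k else 0"]) auto
    moreover have "((\<lambda>x :: real ^ 'n. x $ k) has_derivative (\<lambda>y. y $ k)) (at x)"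
      by (rule bounded_linear_imp_has_derivative) (rule bounded_linear_vec_nth)
    from has_derivative_compose[OF this that[unfolded has_field_derivative_def]]
    have "((\<lambda>x. g (x $ k)) has_derivative (\<lambda>y. g' (x $ k) * y $ k)) (at x)" .
    ultimately show ?thesis by simp
  qed
  let ?D = "\<lambda>i x :: real ^ 'n. if i = k then h' (x $ k) else 0"
  let ?E = "\<lambda>i j x :: real ^ 'n. if i = k then if j = k then h'' (x $ k) else 0 else 0"
  have 2: "(?D i has_derivative (\<lambda>y. \<Sum>j\<in>UNIV. ?E i j x * y $ j)) (at x)" if "x \<in> S" for i x
    using *[of h' h'' x, OF h'[OF that]] by (cases "i = k") (simp_all cong: if_cong)
  have 3: "continuous_on S (?E i j)" for i j
    using h'' by (cases "i = k"; cases "j = k") simp_all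
  have 1: "((\<lambda>x. h (x $ k)) has_derivative (\<lambda>y. \<Sum>i\<in>UNIV. ?D i x * y $ i)) (at x)" if "x \<in> S" for x
    using *[of h h' x, OF h[OF that]] .
  show "C2_on S (\<lambda>x. h (x $ k))"
    by (rule C2_onI(1)[OF S, where D = ?D and E = ?E]) (fact 1 2 3)+
  show "laplacian (\<lambda>x. h (x $ k)) x = h'' (x $ k)" if "x \<in> S" for x
  proof -
    have "laplacian (\<lambda>x. h (x $ k)) x = (\<Sum>i\<in>UNIV. ?E i i x)"
      by (rule C2_onI(2)[OF S, where D = ?D and E = ?E]) (fact 1 2 3 that)+
    then show ?thesis by (simp cong: if_cong)
  qed
qed

text \<open>The radial identity for \<open>|x - a|^(-2 m)\<close>. For \<open>m = d\<close> the
  numerator is \<open>2 d^2 + 4 d\<close>, positive in every dimension, which gives strictly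
  subharmonic poles with natural exponents only.\<close>

lemma C2_on_inverse_power:
  fixes S :: "(real ^ 'n::finite) set"
  defines "d \<equiv> real CARD('n)"
  assumes S: "open S" and a: "a \<notin> S"
  shows "C2_on S (\<lambda>x. 1 / ((x - a) \<bullet> (x - a)) ^ m)"
    and "\<And>x. x \<in> S \<Longrightarrow> laplacian (\<lambda>x. 1 / ((x - a) \<bullet> (x - a)) ^ m) x
      = (4 * real m * (real m + 1) - 2 * real m * d) / ((x - a) \<bullet> (x - a)) ^ (m + 1)"
proof -
  define q where "q = (\<lambda>x. (x - a) \<bullet> (x - a))"
  have qpos: "q x > 0" if "x \<in> S" for x using a that by (auto simp: q_def)
  have q': "(q has_derivative (\<lambda>h. 2 * ((x - a) \<bullet> h))) (at x)" for x
    unfolding q_def by (auto intro!: derivative_eq_intros simp: inner_commute)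
  have r': "((\<lambda>x. 1 / q x ^ l) has_derivative (\<lambda>h. - 2 * real l / q x ^ (l + 1) * ((x - a) \<bullet> h))) (at x)"
    if "x \<in> S" for x l
  proof -
    have "((\<lambda>s. 1 / s ^ l) has_real_derivative (- real l / q x ^ (l + 1))) (at (q x))"
    proof -
      have "((\<lambda>s. 1 / s ^ l) has_real_derivative
          (0 * q x ^ l - 1 * (real l * q x ^ (l - 1))) / (q x ^ l * q x ^ l)) (at (q x))"
        using qpos[OF that] by (auto intro!: derivative_eq_intros)
      moreover have "(0 * q x ^ l - 1 * (real l * q x ^ (l - 1))) / (q x ^ l * q x ^ l)
          = - real l / q x ^ (l + 1)"
        using qpos[OF that] by (cases l) (auto simp: field_simps)
      ultimately show ?thesis by metis
    qed
    from has_derivative_compose[OF q' this[unfolded has_field_derivative_def]]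
    show ?thesis by (rule has_derivative_eq_rhs) (auto simp: field_simps)
  qed
  let ?D = "\<lambda>i x. - 2 * real m * (x - a) $ i * (1 / q x ^ (m + 1))"
  let ?E = "\<lambda>i j x. (if i = j then - 2 * real m / q x ^ (m + 1) else 0)
    + 4 * real m * (real m + 1) * (x - a) $ i * (x - a) $ j / q x ^ (m + 2)"
  have 1: "((\<lambda>x. 1 / q x ^ m) has_derivative (\<lambda>h. \<Sum>i\<in>UNIV. ?D i x * h $ i)) (at x)" if "x \<in> S" for x
    using r'[OF that, of m] by (rule has_derivative_eq_rhs)
      (auto simp: inner_vec_def sum_distrib_left sum_divide_distrib intro!: ext sum.cong)
  have 2: "(?D i has_derivative (\<lambda>h. \<Sum>j\<in>UNIV. ?E i j x * h $ j)) (at x)" if "x \<in> S" for i x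
  proof -
    have c: "((\<lambda>x. - 2 * real m * (x - a) $ i) has_derivative (\<lambda>h. - 2 * real m * h $ i)) (at x)"
      by (auto intro!: derivative_eq_intros bounded_linear_imp_has_derivative bounded_linear_vec_nth)
    have "(\<Sum>j\<in>UNIV. ?E i j x * h $ j) = - 2 * real m / q x ^ (m + 1) * h $ i
        + 4 * real m * (real m + 1) * (x - a) $ i / q x ^ (m + 2) * ((x - a) \<bullet> h)" for h
    proof -
      have "(\<Sum>j\<in>UNIV. ?E i j x * h $ j) = (\<Sum>j\<in>UNIV. (if i = j then - 2 * real m / q x ^ (m + 1) * h $ i else 0)
        + 4 * real m * (real m + 1) * (x - a) $ i / q x ^ (m + 2) * ((x - a) $ j * h $ j))"
        by (rule sum.cong) (auto simp: algebra_simps)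
      then show ?thesis by (simp add: sum.distrib sum_distrib_left inner_vec_def)
    qed
    then show ?thesis
      by (intro has_derivative_eq_rhs[OF has_derivative_mult[OF c r'[OF that, of "m + 1"]]] ext)
        (simp add: algebra_simps)
  qed
  have 3: "continuous_on S (?E i j)" for i j
  proof -
    have "continuous_on S q" unfolding q_def by (intro continuous_intros)
    moreover have "q x \<noteq> 0" if "x \<in> S" for x using qpos[OF that] by simp
    ultimately show ?thesis
      by (cases "i = j") (simp_all only: if_True if_False,
        (intro continuous_intros; simp)+)
  qed
  have "C2_on S (\<lambda>x. 1 / q x ^ m)"
    by (rule C2_onI(1)[OF S, where D = ?D and E = ?E]) (fact 1 2 3)+
  then show "C2_on S (\<lambda>x. 1 / ((x - a) \<bullet> (x - a)) ^ m)" by (simp add: q_def)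
  show "laplacian (\<lambda>x. 1 / ((x - a) \<bullet> (x - a)) ^ m) x
      = (4 * real m * (real m + 1) - 2 * real m * d) / ((x - a) \<bullet> (x - a)) ^ (m + 1)" if "x \<in> S" for x
  proof -
    have "laplacian (\<lambda>x. 1 / q x ^ m) x = (\<Sum>i\<in>UNIV. ?E i i x)"
      by (rule C2_onI(2)[OF S, where D = ?D and E = ?E]) (fact 1 2 3 that)+
    also have "\<dots> = - 2 * real m * d / q x ^ (m + 1) + 4 * real m * (real m + 1) / q x ^ (m + 2) * q x"
    proof -
      have "(\<Sum>i\<in>UNIV. ?E i i x) = (\<Sum>i\<in>(UNIV :: 'n set). - 2 * real m / q x ^ (m + 1)
          + 4 * real m * (real m + 1) / q x ^ (m + 2) * ((x - a) $ i * (x - a) $ i))"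
        by (rule sum.cong) auto
      also have "\<dots> = d * (- 2 * real m / q x ^ (m + 1))
          + 4 * real m * (real m + 1) / q x ^ (m + 2) * (\<Sum>i\<in>UNIV. (x - a) $ i * (x - a) $ i)"
        unfolding sum.distrib sum_distrib_left[symmetric] by (simp only: sum_constant d_def)
      also have "(\<Sum>i\<in>UNIV. (x - a) $ i * (x - a) $ i) = q x"
        by (simp add: q_def inner_vec_def)
      finally show ?thesis by simp
    qed
    also have "\<dots> = (4 * real m * (real m + 1) - 2 * real m * d) / q x ^ (m + 1)"
      using qpos[OF that] by (simp add: field_simps)
    finally show ?thesis by (simp add: q_def)
  qed
qed

section \<open>Maximum principles in the half space\<close>

text \<open>The second derivative test along each axis: a positive pure second derivative at
  \<open>x\<close>, where the first derivative vanishes, would make \<open>w\<close> increase just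
  after \<open>x\<close>.\<close>

lemma laplacian_nonpos_at_local_max:
  fixes w :: "real ^ 'n::finite \<Rightarrow> real"
  assumes S: "open S" "x \<in> S" and w: "C2_on S w" and max: "\<And>y. y \<in> S \<Longrightarrow> w y \<le> w x"
  shows "laplacian w x \<le> 0"
proof -
  have "partial_derivative i (partial_derivative i w) x \<le> 0" for i
  proof (rule ccontr)
    let ?l = "partial_derivative i (partial_derivative i w) x"
    assume "\<not> ?l \<le> 0"
    then have pos: "?l > 0" by simp
    define \<gamma> where "\<gamma> = (\<lambda>s. x + s *\<^sub>R axis i 1 :: real ^ 'n)"
    obtain e where e: "e > 0" "ball x e \<subseteq> S" using S openE by blast
    have \<gamma>S: "\<gamma> s \<in> S" if "\<bar>s\<bar> < e" for s
      using that e by (intro subsetD[OF e(2)]) (simp add: \<gamma>_def dist_norm)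
    have line: "((\<lambda>s. h (\<gamma> s)) has_real_derivative D i) (at s)"
      if "(h has_derivative (\<lambda>y. \<Sum>j\<in>UNIV. D j * y $ j)) (at (\<gamma> s))" for h D s
    proof -
      have "(\<gamma> has_derivative (\<lambda>r. r *\<^sub>R axis i 1)) (at s)"
        unfolding \<gamma>_def by (auto intro!: derivative_eq_intros)
      from has_derivative_compose[OF this that] show ?thesis
        unfolding has_field_derivative_def
        by (rule has_derivative_eq_rhs)
          (simp add: sum_distrib_left[symmetric] sum_mult_axis mult.left_commute mult.commute fun_eq_iff)
    qed
    have d1: "((\<lambda>s. w (\<gamma> s)) has_real_derivative partial_derivative i w (\<gamma> s)) (at s)" if "\<bar>s\<bar> < e" for s
      by (rule line[OF C2_on_derivs(1)[OF w \<gamma>S[OF that]]])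
    have d2: "((\<lambda>s. partial_derivative i w (\<gamma> s)) has_real_derivative ?l) (at 0)"
      using line[OF C2_on_derivs(2)[OF w \<gamma>S], of 0 i] e by (simp add: \<gamma>_def)
    have "partial_derivative i w (\<gamma> 0) = 0"
      by (rule DERIV_local_max[OF d1, of 0 e]) (use e \<gamma>S max in \<open>auto simp: \<gamma>_def\<close>)
    with DERIV_pos_inc_right[OF d2 pos] obtain \<delta> where \<delta>: "\<delta> > 0"
      "\<And>h. 0 < h \<Longrightarrow> h < \<delta> \<Longrightarrow> partial_derivative i w (\<gamma> h) > 0"
      by (auto simp: \<gamma>_def)
    define r where "r = min \<delta> e / 2"
    have r: "0 < r" "r < \<delta>" "r < e" using \<delta> e by (auto simp: r_def)
    have "w (\<gamma> 0) < w (\<gamma> r)"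
    proof (rule DERIV_pos_imp_increasing_open[OF r(1)])
      show "\<exists>y. ((\<lambda>s. w (\<gamma> s)) has_real_derivative y) (at s) \<and> 0 < y" if "0 < s" "s < r" for s
        using d1[of s] \<delta>(2)[of s] that r by (intro exI conjI) auto
      have "isCont (\<lambda>s. w (\<gamma> s)) s" if "s \<in> {0..r}" for s
        using DERIV_isCont[OF d1, of s] that r by auto
      then show "continuous_on {0..r} (\<lambda>s. w (\<gamma> s))"
        by (simp add: continuous_at_imp_continuous_on)
    qed
    with max[OF \<gamma>S, of r] r show False by (simp add: \<gamma>_def)
  qed
  then show ?thesis unfolding laplacian_def by (simp add: sum_nonpos)
qed

text \<open>A positive maximum would be interior, where the Laplacian is nonpositive. Asking for a
  sign only where \<open>w > 0\<close> suits nonlinear comparison: monotonicity of \<open>f\<close>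
  controls a difference exactly where it is positive.\<close>

lemma strict_maximum_principle:
  fixes w :: "real ^ 'n::finite \<Rightarrow> real"
  assumes S: "open S" "bounded S" and w: "C2_on S w" "continuous_on (closure S) w"
    and lap: "\<And>x. x \<in> S \<Longrightarrow> w x > 0 \<Longrightarrow> laplacian w x > 0"
    and bd: "\<And>x. x \<in> frontier S \<Longrightarrow> w x \<le> 0"
    and x: "x \<in> closure S"
  shows "w x \<le> 0"
proof -
  have "compact (closure S)" using S by simp
  moreover have "closure S \<noteq> {}" using x by auto
  ultimately obtain y where y: "y \<in> closure S" "\<And>z. z \<in> closure S \<Longrightarrow> w z \<le> w y"
    using continuous_attains_sup[OF _ _ w(2)] by metis
  have "w y \<le> 0"
  proof (cases "y \<in> S")
    case True
    have "laplacian w y \<le> 0"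
      by (rule laplacian_nonpos_at_local_max[OF S(1) True w(1)]) (use y closure_subset in blast)
    with lap[OF True] show ?thesis by linarith
  next
    case False
    with y S have "y \<in> frontier S" by (simp add: frontier_def interior_open)
    then show ?thesis by (rule bd)
  qed
  with y(2)[OF x] show ?thesis by linarith
qed

lemma open_half_space: "open (half_space k)"
proof -
  have "half_space k = {x. x $ k > 0}" by (simp add: half_space_def)
  then show ?thesis using open_halfspace_component_gt_cart[of 0 k] by simp
qed

lemma half_space_eq: "half_space k = {x. axis k 1 \<bullet> x > 0}"
  by (simp add: half_space_def cart_eq_inner_axis inner_commute)

lemma closure_half_space: "closure (half_space k) = {x. x $ k \<ge> 0}"
  unfolding half_space_eq
  by (subst closure_halfspace_gt) (auto simp: cart_eq_inner_axis inner_commute)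

lemma frontier_half_space: "frontier (half_space k) = {x. x $ k = 0}"
  unfolding half_space_eq
  by (subst frontier_halfspace_gt) (auto simp: cart_eq_inner_axis inner_commute)

text \<open>
  The barrier is \<open>1 - L\<^sup>2\<^sup>d / |y - a|\<^sup>2\<^sup>d\<close>, where \<open>a\<close> lies at depth \<open>L\<close> below the projection of \<open>x\<close> to
  the boundary. The exponent exceeds that of the fundamental solution, which makes the barrier strictly
  superharmonic, so the maximum principle is only needed in its strict form.
\<close>

lemma subharmonic_boundary_growth:
  fixes w :: "real ^ 'n::finite \<Rightarrow> real" and k :: 'n
  assumes w: "C2_on (half_space k) w" "continuous_on (closure (half_space k)) w"
    and lap: "\<And>x. x \<in> half_space k \<Longrightarrow> w x > 0 \<Longrightarrow> laplacian w x \<ge> 0"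
    and bd: "\<And>x. x \<in> frontier (half_space k) \<Longrightarrow> w x \<le> 0"
    and m: "m > 0" "\<And>y. y \<in> closure (half_space k) \<Longrightarrow> dist (x - (x $ k) *\<^sub>R axis k 1) y \<le> L \<Longrightarrow> w y \<le> m"
    and x: "x \<in> half_space k" "x $ k \<le> L"
  shows "w x \<le> 4 * real CARD('n) * m * x $ k / L"
proof -
  define e where "e = (axis k 1 :: real ^ 'n)"
  define d where "d = CARD('n)"
  define t where "t = x $ k"
  define z where "z = x - t *\<^sub>R e"
  define a where "a = z - L *\<^sub>R e"
  have t: "0 < t" "t \<le> L" using x by (auto simp: half_space_def t_def)
  then have L: "L > 0" by simp
  have d: "d \<ge> 1" by (simp add: d_def Suc_leI)
  have zk: "z $ k = 0" and ak: "a $ k = - L" by (simp_all add: z_def a_def e_def t_def)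
  have a: "a \<notin> half_space k" using ak L by (simp add: half_space_def)
  have qz: "(y - a) \<bullet> (y - a) = (y - z) \<bullet> (y - z) + 2 * L * y $ k + L\<^sup>2" for y
  proof -
    have eq: "y - a = (y - z) + L *\<^sub>R e" by (simp add: a_def)
    have "(y - z) \<bullet> e = y $ k" "e \<bullet> (y - z) = y $ k"
      using zk by (simp_all add: e_def inner_axis inner_axis')
    moreover have "e \<bullet> e = 1" by (simp add: e_def inner_axis_axis)
    ultimately show ?thesis
      unfolding eq by (simp add: inner_add_left inner_add_right power2_eq_square distrib_left del: inner_diff_left inner_diff_right)
  qed
  define S where "S = half_space k \<inter> ball z L"
  have Sop: "open S" "bounded S" by (auto simp: S_def open_half_space)
  have SH: "S \<subseteq> half_space k" by (auto simp: S_def)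
  have "closed ({y :: real ^ 'n. y $ k \<ge> 0} \<inter> cball z L)"
    unfolding closure_half_space[symmetric] by (intro closed_Int closed_closure closed_cball)
  moreover have "S \<subseteq> {y. y $ k \<ge> 0} \<inter> cball z L" by (auto simp: S_def half_space_def)
  ultimately have Scl: "closure S \<subseteq> {y. y $ k \<ge> 0} \<inter> cball z L" by (rule closure_minimal[rotated])
  have Sfr: "y $ k = 0 \<or> dist z y = L" if "y \<in> frontier S" for y
  proof -
    have "y \<in> closure S" "y \<notin> S"
      using that by (simp_all add: frontier_def interior_open[OF Sop(1)])
    then show ?thesis using Scl by (auto simp: S_def half_space_def)
  qed
  define g where "g = (\<lambda>y. 1 / ((y - a) \<bullet> (y - a)) ^ d)"
  define b where "b = (\<lambda>y. 1 - (L\<^sup>2) ^ d * g y)"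
  \<comment> \<open>The factor \<open>2 * m\<close> is matched to \<open>b \<ge> 1 / 2\<close> on
    the spherical part of the boundary, where it gives
    \<open>2 * m * b \<ge> m \<ge> w\<close>.\<close>
  define W where "W = (\<lambda>y. 1 * w y + 1 * ((- 2 * m) * 1 + (2 * m * (L\<^sup>2) ^ d) * g y))"
  have Wb: "W y = w y - 2 * m * b y" for y by (simp add: W_def b_def algebra_simps)
  have q: "(y - a) \<bullet> (y - a) \<ge> L\<^sup>2" if "y $ k \<ge> 0" for y
    using that L by (simp add: qz)
  have b0: "b y \<ge> 0" if "y $ k \<ge> 0" for y
  proof -
    have "(L\<^sup>2) ^ d \<le> ((y - a) \<bullet> (y - a)) ^ d" using q[OF that] by (intro power_mono) auto
    moreover have "0 < (L\<^sup>2) ^ d" using L by simp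
    ultimately show ?thesis by (simp add: b_def g_def divide_le_eq_1)
  qed
  \<comment> \<open>On this sphere the squared distance to \<open>a\<close> is at least
    \<open>2 * L\<^sup>2\<close>, so \<open>b \<ge> 1 - 2^(-d)\<close>.\<close>
  have b1: "b y \<ge> 1 / 2" if "y $ k \<ge> 0" "dist z y = L" for y
  proof -
    have "(y - z) \<bullet> (y - z) = L\<^sup>2"
      using that by (simp add: dist_norm norm_minus_commute power2_norm_eq_inner[symmetric])
    then have "2 * L\<^sup>2 \<le> (y - a) \<bullet> (y - a)" using that L by (simp add: qz)
    then have "(2 * L\<^sup>2) ^ d \<le> ((y - a) \<bullet> (y - a)) ^ d" using L by (intro power_mono) auto
    moreover have "2 * (L\<^sup>2) ^ d \<le> (2 * L\<^sup>2) ^ d"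
      using L d self_le_power[of "2::real" d] by (simp add: power_mult_distrib)
    ultimately have *: "2 * (L\<^sup>2) ^ d \<le> ((y - a) \<bullet> (y - a)) ^ d" by simp
    moreover have "0 < ((y - a) \<bullet> (y - a)) ^ d"
      using L by (intro less_le_trans[OF _ *]) simp
    ultimately show ?thesis by (simp add: b_def g_def field_simps)
  qed
  note g2 = C2_on_inverse_power[OF open_half_space a, where m = d, folded g_def]
  note c2 = C2_on_const[OF open_half_space[of k], where c = 1]
  note bg2 = C2_on_lincomb[OF open_half_space c2(1) g2(1), where a = "- 2 * m" and b = "2 * m * (L\<^sup>2) ^ d"]
  note W2 = C2_on_lincomb[OF open_half_space w(1) bg2(1), where a = 1 and b = 1, folded W_def]
  have lapW: "laplacian W y > 0" if "y \<in> S" "W y > 0" for y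
  proof -
    have y: "y \<in> half_space k" "y $ k \<ge> 0" using that SH by (auto simp: half_space_def)
    have "w y > 0" using that(2) b0[OF y(2)] m(1) Wb[of y]
      by (smt (verit, best) mult_nonneg_nonneg)
    then have 1: "laplacian w y \<ge> 0" using lap y by blast
    have "L\<^sup>2 > 0" using L by simp
    then have "(y - a) \<bullet> (y - a) > 0" using q[OF y(2)] by linarith
    then have "((y - a) \<bullet> (y - a)) ^ (d + 1) > 0" by simp
    moreover have "4 * real d * (real d + 1) - 2 * real d * real d > 0"
      using d by (simp add: algebra_simps add_pos_pos)
    ultimately have 2: "laplacian g y > 0"
      unfolding g2(2)[OF y(1)] d_def[symmetric] by (rule divide_pos_pos[rotated])
    have "laplacian W y = laplacian w y + 2 * m * (L\<^sup>2) ^ d * laplacian g y"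
      using W2(2)[OF y(1)] bg2(2)[OF y(1)] c2(2)[OF y(1)] by simp
    moreover have "2 * m * (L\<^sup>2) ^ d * laplacian g y > 0" using m(1) L 2 by simp
    ultimately show ?thesis using 1 by linarith
  qed
  have Wcont: "continuous_on (closure S) W"
  proof -
    have "continuous_on (closure S) w"
      using continuous_on_subset[OF w(2) closure_mono[OF SH]] .
    moreover have "(y - a) \<bullet> (y - a) \<noteq> 0" if "y \<in> closure S" for y
      using q[of y] that Scl L by (smt (verit) IntE mem_Collect_eq subsetD zero_less_power)
    ultimately show ?thesis unfolding W_def g_def
      by (intro continuous_intros) (auto simp: power_eq_0_iff)
  qed
  have Wbd: "W y \<le> 0" if "y \<in> frontier S" for y
  proof -
    have y: "y $ k \<ge> 0" "dist z y \<le> L" using that Scl by (auto simp: frontier_def)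
    from Sfr[OF that] show ?thesis
    proof
      assume "y $ k = 0"
      then have "w y \<le> 0" using bd by (simp add: frontier_half_space)
      then show ?thesis using b0[OF y(1)] m(1) Wb[of y] by (smt (verit) mult_nonneg_nonneg)
    next
      assume "dist z y = L"
      from b1[OF y(1) this] m(1) have "2 * m * b y \<ge> 2 * m * (1 / 2)" by (intro mult_left_mono) auto
      moreover have "w y \<le> m" using m(2)[of y] y by (simp add: closure_half_space z_def t_def e_def)
      ultimately show ?thesis by (simp add: Wb)
    qed
  qed
  show ?thesis
  \<comment> \<open>\<open>S\<close> is cut out by an open ball and \<open>x\<close> lies at
    distance \<open>t\<close> from \<open>z\<close>, so \<open>x\<close> is outside \<open>S\<close>
    when \<open>t = L\<close>; the bound \<open>m\<close> at \<open>x\<close> itself then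
    suffices.\<close>
  proof (cases "t = L")
    case True
    have "w x \<le> m"
      using m(2)[of x] x t by (simp add: closure_half_space dist_norm t_def)
    also have "m \<le> 4 * real d * m" using d m(1) by simp
    finally show ?thesis using True L by (simp add: t_def d_def)
  next
    case False
    have zx: "x - z = t *\<^sub>R e" by (simp add: z_def)
    have "dist z x = t" using t by (simp add: dist_norm norm_minus_commute[of z x] zx e_def)
    then have "x \<in> S" using False t x by (simp add: S_def)
    then have "W x \<le> 0"
      using strict_maximum_principle[OF Sop C2_on_subset[OF W2(1) SH] Wcont lapW Wbd] closure_subset by blast
    have "(x - a) \<bullet> (x - a) = (L + t)\<^sup>2"
      using qz[of x] by (simp add: zx e_def inner_axis_axis t_def power2_eq_square algebra_simps)
    then have "b x = 1 - (L / (L + t)) ^ (2 * d)"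
      by (simp add: b_def g_def power_mult power_divide)
    moreover have "L / (L + t) = 1 + - (t / (L + t))" using L t by (simp add: field_simps)
    ultimately have "b x = 1 - (1 + - (t / (L + t))) ^ (2 * d)" by simp
    \<comment> \<open>Bernoulli bounds \<open>b x\<close> by \<open>2 d t / (L + t)\<close>; with
      the factor \<open>2 * m\<close> this is the origin of the constant \<open>4 d\<close>.\<close>
    moreover have "1 + real (2 * d) * (- (t / (L + t))) \<le> (1 + - (t / (L + t))) ^ (2 * d)"
      by (rule Bernoulli_inequality) (use L t in \<open>simp add: field_simps\<close>)
    ultimately have "b x \<le> 2 * d * t / (L + t)" by simp
    also have "\<dots> \<le> 2 * d * t / L" using L t by (intro divide_left_mono) auto
    finally have "2 * m * b x \<le> 2 * m * (2 * d * t / L)" using m(1) by (intro mult_left_mono) auto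
    then show ?thesis using \<open>W x \<le> 0\<close> by (simp add: Wb t_def d_def mult_ac)
  qed
qed

text \<open>On the half ball of radius \<open>L\<close> about the projection of \<open>x\<close>,
  \<open>w\<close> is at most \<open>\<epsilon> * L + C\<close>, so the boundary growth estimate
  bounds \<open>w x\<close> by \<open>4 d (\<epsilon> + C / L) * x $ k\<close>. Now \<open>L\<close>
  tends to infinity, then \<open>\<epsilon>\<close> to 0.\<close>

lemma phragmen_lindelof_half_space:
  fixes w :: "real ^ 'n::finite \<Rightarrow> real" and k :: 'n
  assumes w: "C2_on (half_space k) w" "continuous_on (closure (half_space k)) w"
    and lap: "\<And>x. x \<in> half_space k \<Longrightarrow> w x > 0 \<Longrightarrow> laplacian w x \<ge> 0"
    and bd: "\<And>x. x \<in> frontier (half_space k) \<Longrightarrow> w x \<le> 0"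
    and growth: "\<And>\<epsilon>. \<epsilon> > 0 \<Longrightarrow> \<exists>C. \<forall>x\<in>half_space k. w x \<le> \<epsilon> * x $ k + C"
    and x: "x \<in> closure (half_space k)"
  shows "w x \<le> 0"
proof (cases "x \<in> half_space k")
  case False
  then show ?thesis using x bd by (simp add: frontier_def open_half_space interior_open)
next
  case True
  define c where "c = 4 * real CARD('n) * x $ k"
  define z where "z = x - x $ k *\<^sub>R axis k 1"
  have t: "x $ k > 0" using True by (simp add: half_space_def)
  then have c: "c > 0" by (simp add: c_def)
  have "w x \<le> c * \<epsilon>" if \<epsilon>: "\<epsilon> > 0" for \<epsilon>
  proof -
    obtain C0 where C0: "\<And>y. y \<in> half_space k \<Longrightarrow> w y \<le> \<epsilon> * y $ k + C0" using growth[OF \<epsilon>] by blast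
    define C where "C = max C0 0"
    have C: "C \<ge> 0" "w y \<le> \<epsilon> * y $ k + C" if "y \<in> closure (half_space k)" for y
    proof -
      show "w y \<le> \<epsilon> * y $ k + C"
      proof (cases "y $ k = 0")
        case True
        then show ?thesis using bd[of y] by (simp add: frontier_half_space C_def)
      next
        case False
        then have "y \<in> half_space k" using that by (simp add: closure_half_space half_space_def)
        then show ?thesis using C0[of y] by (simp add: C_def)
      qed
    qed (simp add: C_def)
    have C0': "C \<ge> 0" by (simp add: C_def)
    have "w x \<le> c * \<epsilon> + c * C * (1 / L)" if L: "L \<ge> x $ k" for L
    proof -
      have Lp: "L > 0" using L t by linarith
      have "w y \<le> \<epsilon> * L + C" if y: "y \<in> closure (half_space k)" "dist z y \<le> L" for y
      proof -
        have "y $ k = (y - z) $ k" by (simp add: z_def)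
        also have "\<dots> \<le> norm (y - z)" using component_le_norm_cart[of "y - z" k] by linarith
        finally have "y $ k \<le> L" using y by (simp add: dist_norm norm_minus_commute)
        then have "\<epsilon> * y $ k \<le> \<epsilon> * L" using \<epsilon> by simp
        then show ?thesis using C(2)[OF y(1)] by linarith
      qed
      moreover have "\<epsilon> * L + C > 0" using \<epsilon> Lp C0' by (simp add: add_pos_nonneg)
      ultimately have "w x \<le> 4 * real CARD('n) * (\<epsilon> * L + C) * x $ k / L"
        using subharmonic_boundary_growth[OF w lap bd _ _ True L] unfolding z_def by blast
      also have "\<dots> = c * \<epsilon> + c * C * (1 / L)" using Lp by (simp add: c_def field_simps)
      finally show ?thesis .
    qed
    then have "\<forall>\<^sub>F L in at_top. w x \<le> c * \<epsilon> + c * C * (1 / L)"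
      by (intro eventually_mono[OF eventually_ge_at_top[of "x $ k"]])
    moreover have "((\<lambda>L. c * \<epsilon> + c * C * (1 / L)) \<longlongrightarrow> c * \<epsilon> + c * C * 0) at_top"
      by (intro tendsto_intros tendsto_divide_0[OF tendsto_const] filterlim_at_top_imp_at_infinity filterlim_ident)
    ultimately show ?thesis
      using tendsto_lowerbound[of "\<lambda>L. c * \<epsilon> + c * C * (1 / L)" _ at_top "w x"] by simp
  qed
  from this[of "_ / c"] c have "w x \<le> \<epsilon>" if "\<epsilon> > 0" for \<epsilon>
    using that by (metis divide_pos_pos nonzero_mult_div_cancel_left order_less_irrefl times_divide_eq_right)
  then show ?thesis by (simp add: field_le_epsilon)
qed

section \<open>Mean values and a Harnack inequality\<close>

text \<open>Three sizes are used: \<open>cube 1\<close> contains the support of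
  \<open>kernel\<close>, \<open>cube 2\<close> still contains that support after a shift by less
  than 1 along an axis, and \<open>cube 3\<close> contains all such shifts of
  \<open>cube 2\<close>.\<close>

abbreviation cube :: "real \<Rightarrow> (real ^ 'n::finite) set" where
  "cube r \<equiv> cbox (\<chi> i. - r) (\<chi> i. r)"

lemma mem_cube: "y \<in> cube r \<longleftrightarrow> (\<forall>i. \<bar>y $ i\<bar> \<le> r)"
  by (auto simp: mem_box_cart abs_le_iff) (metis minus_le_iff)+

lemma cube_mono: "r \<le> s \<Longrightarrow> cube r \<subseteq> cube s"
  unfolding subset_iff mem_cube by (meson order_trans)

text \<open>\<open>D\<close> is the derivative of the translates of \<open>F\<close>, all of which have the same integral.\<close>

lemma integral_partial_derivative_eq_0:
  fixes F D :: "real ^ 'n::finite \<Rightarrow> real"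
  assumes F: "continuous_on (cube 3) F"
    and F': "\<And>y. y \<in> cube 3 \<Longrightarrow> ((\<lambda>s. F (y + s *\<^sub>R axis i 1)) has_real_derivative D y) (at 0)"
    and D: "continuous_on (cube 3) D"
    and supp: "\<And>y. norm y \<ge> 1 \<Longrightarrow> F y = 0"
  shows "integral (cube 2) D = 0"
proof -
  define e where "e = (axis i 1 :: real ^ 'n)"
  define U where "U = {-1<..<1::real}"
  have e: "\<bar>e $ j\<bar> \<le> 1" for j by (simp add: e_def axis_def)
  have sh: "y + h *\<^sub>R e \<in> cube 3" if "y \<in> cube 2" "h \<in> U" for y h
  proof -
    have "\<bar>y $ j + h * e $ j\<bar> \<le> 3" for j
    proof -
      have "\<bar>h * e $ j\<bar> \<le> 1 * 1" using that e[of j] unfolding abs_mult U_def by (intro mult_mono) auto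
      then show ?thesis using that(1)[unfolded mem_cube, rule_format, of j] by linarith
    qed
    then show ?thesis by (simp add: mem_cube)
  qed
  have const: "integral (cube 2) (\<lambda>y. F (y + h *\<^sub>R e)) = integral (cube 1) F" if h: "h \<in> U" for h
  proof -
    define a b where "a = (\<chi> i. - 2) + h *\<^sub>R e" and "b = (\<chi> i. 2) + h *\<^sub>R e"
    have "cube 1 \<subseteq> cbox a b"
    proof
      fix y :: "real ^ 'n" assume y: "y \<in> cube 1"
      have "- 2 + h * e $ j \<le> y $ j \<and> y $ j \<le> 2 + h * e $ j" for j
      proof -
        have "\<bar>h * e $ j\<bar> \<le> 1 * 1" using h e[of j] unfolding abs_mult U_def by (intro mult_mono) auto
        then show ?thesis using y[unfolded mem_cube, rule_format, of j] by linarith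
      qed
      then show "y \<in> cbox a b" by (simp add: mem_box_cart a_def b_def)
    qed
    moreover have "F y = 0" if "y \<notin> cube 1" for y
    proof (rule supp)
      from that obtain j where "1 < \<bar>y $ j\<bar>" by (auto simp: mem_cube not_le)
      then show "1 \<le> norm y" using component_le_norm_cart[of y j] by linarith
    qed
    moreover have "F integrable_on cube 1"
      by (rule integrable_continuous, rule continuous_on_subset[OF F], rule cube_mono) simp
    then have "(F has_integral integral (cube 1) F) (cube 1)" by (rule integrable_integral)
    ultimately have "(F has_integral integral (cube 1) F) (cbox a b)"
      using has_integral_on_superset by blast
    then have "((\<lambda>y. F (1 *\<^sub>R y + h *\<^sub>R e)) has_integral integral (cube 1) F /\<^sub>R 1 ^ DIM(real ^ 'n))
        (cbox ((a - h *\<^sub>R e) /\<^sub>R 1) ((b - h *\<^sub>R e) /\<^sub>R 1))"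
      by (subst has_integral_affinity_iff) simp_all
    then have "((\<lambda>y. F (y + h *\<^sub>R e)) has_integral integral (cube 1) F) (cube 2)"
      by (simp add: a_def b_def)
    then show ?thesis by (rule integral_unique)
  qed
  have "((\<lambda>h. integral (cube 2) (\<lambda>y. F (y + h *\<^sub>R e))) has_real_derivative
      integral (cube 2) (\<lambda>y. D (y + 0 *\<^sub>R e))) (at 0 within U)"
  proof (rule leibniz_rule_field_derivative)
    show "((\<lambda>h. F (y + h *\<^sub>R e)) has_real_derivative D (y + h *\<^sub>R e)) (at h within U)"
      if "h \<in> U" "y \<in> cube 2" for h y
    proof -
      have "((\<lambda>s. F (y + h *\<^sub>R e + (s - h) *\<^sub>R e)) has_real_derivative D (y + h *\<^sub>R e)) (at h)"
        using F'[OF sh[OF that(2,1)], folded e_def]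
          DERIV_shift[of "\<lambda>s. F (y + h *\<^sub>R e + (s - h) *\<^sub>R e)" "D (y + h *\<^sub>R e)" 0 h] by simp
      moreover have "y + h *\<^sub>R e + (s - h) *\<^sub>R e = y + s *\<^sub>R e" for s by (simp add: algebra_simps)
      ultimately show ?thesis by (simp add: has_field_derivative_at_within)
    qed
    show "(\<lambda>y. F (y + h *\<^sub>R e)) integrable_on cube 2" if "h \<in> U" for h
      by (rule integrable_continuous, rule continuous_on_compose2[OF F])
        (use sh that in \<open>auto intro!: continuous_intros\<close>)
    show "continuous_on (U \<times> cube 2) (\<lambda>(h, y). D (y + h *\<^sub>R e))"
      unfolding split_beta
      by (rule continuous_on_compose2[OF D]) (use sh in \<open>auto intro!: continuous_intros\<close>)
  qed (auto simp: U_def)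
  moreover have U: "open U" "0 \<in> U" by (auto simp: U_def)
  ultimately have "((\<lambda>h. integral (cube 2) (\<lambda>y. F (y + h *\<^sub>R e))) has_real_derivative
      integral (cube 2) D) (at 0)"
    unfolding at_within_open[OF U(2,1)] by simp
  then have "((\<lambda>h. integral (cube 1) F) has_real_derivative integral (cube 2) D) (at 0)"
    by (rule has_field_derivative_transform_within_open[OF _ \<open>open U\<close> \<open>0 \<in> U\<close>]) (rule const)
  then show ?thesis using DERIV_unique[OF DERIV_const] by metis
qed

text \<open>A truncated paraboloid instead of a smooth bump: only its square is differentiated, and
  only once, and the square of a positive part is continuously differentiable.\<close>

definition kernel :: "real ^ 'n::finite \<Rightarrow> real" where
  "kernel y = max 0 (1 - y \<bullet> y)"

lemma kernel_nonneg: "kernel y \<ge> 0"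
  by (simp add: kernel_def)

lemma kernel_eq_0: "norm y \<ge> 1 \<Longrightarrow> kernel y = 0"
  using power_mono[of 1 "norm y" 2] by (simp add: kernel_def power2_norm_eq_inner)

lemma continuous_on_kernel [continuous_intros]:
  "continuous_on S f \<Longrightarrow> continuous_on S (\<lambda>x. kernel (f x))"
  unfolding kernel_def by (intro continuous_intros)

lemma has_real_derivative_max_0_squared:
  "((\<lambda>t::real. (max 0 t)\<^sup>2) has_real_derivative 2 * max 0 t) (at t)"
proof -
  consider "t > 0" | "t < 0" | "t = 0" by linarith
  then show ?thesis
  proof cases
    case 1
    have "((\<lambda>t::real. t\<^sup>2) has_real_derivative 2 * max 0 t) (at t)"
      using 1 by (auto intro!: derivative_eq_intros)
    then show ?thesis
      by (rule has_field_derivative_transform_within_open[of _ _ _ "{0<..}"]) (use 1 in simp_all)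
  next
    case 2
    have "((\<lambda>t::real. 0) has_real_derivative 2 * max 0 t) (at t)"
      using 2 by simp
    then show ?thesis
      by (rule has_field_derivative_transform_within_open[of _ _ _ "{..<0}"]) (use 2 in simp_all)
  next
    case 3
    have "((\<lambda>h::real. (max 0 h)\<^sup>2 / h) \<longlongrightarrow> 0) (at 0)"
    proof (rule Lim_null_comparison[where g = "\<lambda>h. \<bar>h\<bar>"])
      show "\<forall>\<^sub>F h::real in at 0. norm ((max 0 h)\<^sup>2 / h) \<le> \<bar>h\<bar>"
        by (rule always_eventually) (auto simp: max_def power2_eq_square)
      show "((\<lambda>h::real. \<bar>h\<bar>) \<longlongrightarrow> 0) (at 0)" by (auto intro!: tendsto_eq_intros)
    qed
    then show ?thesis using 3 by (simp add: DERIV_def)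
  qed
qed

lemma kernel_squared_derivative:
  fixes y :: "real ^ 'n::finite"
  shows "((\<lambda>s. (kernel (y + s *\<^sub>R axis i 1))\<^sup>2) has_real_derivative - 4 * kernel y * y $ i) (at 0)"
proof -
  have eq: "1 - (y + s *\<^sub>R axis i 1) \<bullet> (y + s *\<^sub>R axis i 1) = 1 - y \<bullet> y - 2 * s * y $ i - s\<^sup>2" for s
    by (simp add: inner_add_left inner_add_right inner_axis inner_axis' power2_eq_square distrib_left)
  have "((\<lambda>s. 1 - y \<bullet> y - 2 * s * y $ i - s\<^sup>2) has_real_derivative - 2 * y $ i) (at 0)"
    by (auto intro!: derivative_eq_intros)
  then have 1: "((\<lambda>s. 1 - (y + s *\<^sub>R axis i 1) \<bullet> (y + s *\<^sub>R axis i 1)) has_real_derivative - 2 * y $ i) (at 0)"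
    unfolding eq .
  have 2: "((\<lambda>t. (max 0 t)\<^sup>2) has_real_derivative 2 * max 0 (1 - y \<bullet> y))
      (at (1 - (y + 0 *\<^sub>R axis i 1) \<bullet> (y + 0 *\<^sub>R axis i 1)))"
    using has_real_derivative_max_0_squared[of "1 - y \<bullet> y"] by simp
  show ?thesis
    unfolding kernel_def using DERIV_chain2[OF 2 1] by (rule DERIV_cong) simp
qed

text \<open>
  Since \<open>y * kernel y\<close> is \<open>-1/4\<close> times the gradient of \<open>(kernel y)\<^sup>2\<close>, integration by parts turns the
  derivative of the mean over the scale \<open>r\<close> into an integral of the Laplacian against
  \<open>(kernel y)\<^sup>2\<close>.
\<close>

lemma mean_value_subharmonic:
  fixes g :: "real ^ 'n::finite \<Rightarrow> real"
  assumes S: "open S" and g: "C2_on S g" and lap: "\<And>x. x \<in> S \<Longrightarrow> laplacian g x \<ge> 0"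
    and \<rho>: "\<rho> \<ge> 0" "\<And>y. y \<in> cube 3 \<Longrightarrow> z + \<rho> *\<^sub>R y \<in> S"
  shows "g z * integral (cube 2) (kernel :: real ^ 'n \<Rightarrow> real) \<le> integral (cube 2) (\<lambda>y. kernel y * g (z + \<rho> *\<^sub>R y))"
proof -
  define D where "D = (\<lambda>i. partial_derivative i g)"
  define E where "E = (\<lambda>i. partial_derivative i (D i))"
  define J where "J = (\<lambda>r. integral (cube 2) (\<lambda>y. kernel y * g (z + r *\<^sub>R y)))"
  \<comment> \<open>\<open>cube 3\<close> is star-shaped about 0, so the hypothesis at scale
    \<open>\<rho>\<close> covers all smaller scales.\<close>
  have zS: "z + r *\<^sub>R y \<in> S" if "r \<in> {0..\<rho>}" "y \<in> cube 3" for r y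
  proof (cases "\<rho> = 0")
    case True
    then show ?thesis using \<rho>(2)[OF that(2)] that(1) by simp
  next
    case False
    then have "\<bar>r / \<rho>\<bar> \<le> 1" using that(1) by simp
    have "(r / \<rho>) *\<^sub>R y \<in> cube 3"
      unfolding mem_cube
    proof
      fix i
      have "\<bar>(r / \<rho>) * y $ i\<bar> \<le> 1 * 3"
        using \<open>\<bar>r / \<rho>\<bar> \<le> 1\<close> that(2) unfolding abs_mult mem_cube by (intro mult_mono) auto
      then show "\<bar>((r / \<rho>) *\<^sub>R y) $ i\<bar> \<le> 3" by simp
    qed
    from \<rho>(2)[OF this] False show ?thesis by simp
  qed
  have c23: "cube 2 \<subseteq> (cube 3 :: (real ^ 'n) set)" by (rule cube_mono) simp
  have gS: "continuous_on S g"
    using C2_on_derivs(1)[OF g] by (meson continuous_at_imp_continuous_on has_derivative_continuous)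
  have DS: "continuous_on S (D i)" and ES: "continuous_on S (E i)" for i
    using C2_on_derivs(3,4)[OF g] by (simp_all add: D_def E_def)
  have kc: "continuous_on A kernel" for A :: "(real ^ 'n) set" by (intro continuous_intros)
  have aff: "continuous_on A (\<lambda>y. z + r *\<^sub>R y)" for A r by (intro continuous_intros)
  have J': "(J has_real_derivative
      integral (cube 2) (\<lambda>y. kernel y * (\<Sum>i\<in>UNIV. D i (z + r *\<^sub>R y) * y $ i))) (at r within {0..\<rho>})"
    if r: "r \<in> {0..\<rho>}" for r
    unfolding J_def
  proof (rule leibniz_rule_field_derivative[OF _ _ _ r])
    show "((\<lambda>r. kernel y * g (z + r *\<^sub>R y)) has_real_derivative
        kernel y * (\<Sum>i\<in>UNIV. D i (z + s *\<^sub>R y) * y $ i)) (at s within {0..\<rho>})"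
      if "s \<in> {0..\<rho>}" "y \<in> cube 2" for s y
    proof -
      have "((\<lambda>r. z + r *\<^sub>R y) has_derivative (\<lambda>h. h *\<^sub>R y)) (at s)"
        by (auto intro!: derivative_eq_intros)
      from has_derivative_compose[OF this C2_on_derivs(1)[OF g zS]] that c23
      have "((\<lambda>r. g (z + r *\<^sub>R y)) has_derivative (\<lambda>h. (\<Sum>i\<in>UNIV. D i (z + s *\<^sub>R y) * (h *\<^sub>R y) $ i))) (at s)"
        unfolding D_def by blast
      then have "((\<lambda>r. g (z + r *\<^sub>R y)) has_real_derivative (\<Sum>i\<in>UNIV. D i (z + s *\<^sub>R y) * y $ i)) (at s)"
        unfolding has_field_derivative_def
        by (rule has_derivative_eq_rhs) (simp add: fun_eq_iff sum_distrib_left algebra_simps)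
      from DERIV_cmult[OF this, of "kernel y"] show ?thesis by (rule has_field_derivative_at_within)
    qed
    show "(\<lambda>y. kernel y * g (z + s *\<^sub>R y)) integrable_on cube 2" if "s \<in> {0..\<rho>}" for s
      by (rule integrable_continuous)
        (use zS that c23 in \<open>auto intro!: continuous_intros continuous_on_compose2[OF gS]\<close>)
    show "continuous_on ({0..\<rho>} \<times> cube 2)
        (\<lambda>(s, y). kernel y * (\<Sum>i\<in>UNIV. D i (z + s *\<^sub>R y) * y $ i))"
      unfolding split_beta
      by (intro continuous_intros continuous_on_compose2[OF DS]) (use zS c23 in auto)
  qed simp
  have pos: "integral (cube 2) (\<lambda>y. kernel y * (\<Sum>i\<in>UNIV. D i (z + r *\<^sub>R y) * y $ i)) \<ge> 0"
    if r: "r \<in> {0..\<rho>}" for r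
  proof -
    \<comment> \<open>\<open>?A i + ?B i\<close> is the \<open>i\<close>-th partial derivative of
      \<open>(kernel y)\<^sup>2 * D i (z + r *\<^sub>R y)\<close>, so its integral is 0. Summed over
      \<open>i\<close>, \<open>?A\<close> is \<open>- 4\<close> times the integrand in the
      derivative of \<open>J\<close>, while \<open>?B\<close> is \<open>r\<close> times the
      Laplacian against \<open>(kernel y)\<^sup>2\<close> and hence nonnegative.\<close>
    let ?A = "\<lambda>i y. - 4 * kernel y * y $ i * D i (z + r *\<^sub>R y)"
    let ?B = "\<lambda>i y. (kernel y)\<^sup>2 * (r * E i (z + r *\<^sub>R y))"
    have D3: "continuous_on (cube 3) (\<lambda>y. D i (z + r *\<^sub>R y))"
      and E3: "continuous_on (cube 3) (\<lambda>y. E i (z + r *\<^sub>R y))" for i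
      using zS[OF r] by (auto intro!: continuous_intros continuous_on_compose2[OF DS] continuous_on_compose2[OF ES])
    have A: "?A i integrable_on cube 2" and B: "?B i integrable_on cube 2" for i
      by (rule integrable_continuous, intro continuous_intros continuous_on_subset[OF D3 c23]
          continuous_on_subset[OF E3 c23])+
    have AB: "integral (cube 2) (?A i) + integral (cube 2) (?B i) = 0" for i
    proof -
      have "integral (cube 2) (\<lambda>y. ?A i y + ?B i y) = 0"
      proof (rule integral_partial_derivative_eq_0[where F = "\<lambda>y. (kernel y)\<^sup>2 * D i (z + r *\<^sub>R y)"])
        show "((\<lambda>s. (kernel (y + s *\<^sub>R axis i 1))\<^sup>2 * D i (z + r *\<^sub>R (y + s *\<^sub>R axis i 1)))
            has_real_derivative ?A i y + ?B i y) (at 0)" if "y \<in> cube 3" for y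
        proof -
          have "((\<lambda>s. z + r *\<^sub>R (y + s *\<^sub>R axis i 1)) has_derivative (\<lambda>h. h *\<^sub>R (r *\<^sub>R axis i 1))) (at 0)"
            by (auto intro!: derivative_eq_intros)
          moreover have "(D i has_derivative (\<lambda>h. \<Sum>j\<in>UNIV. partial_derivative j (D i) (z + r *\<^sub>R y) * h $ j))
              (at (z + r *\<^sub>R (y + 0 *\<^sub>R axis i 1)))"
            using C2_on_derivs(2)[OF g zS[OF r that], of i] by (simp add: D_def)
          ultimately have "((\<lambda>s. D i (z + r *\<^sub>R (y + s *\<^sub>R axis i 1))) has_derivative
              (\<lambda>h. \<Sum>j\<in>UNIV. partial_derivative j (D i) (z + r *\<^sub>R y) * (h *\<^sub>R (r *\<^sub>R axis i 1)) $ j)) (at 0)"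
            by (rule has_derivative_compose)
          then have "((\<lambda>s. D i (z + r *\<^sub>R (y + s *\<^sub>R axis i 1))) has_real_derivative r * E i (z + r *\<^sub>R y)) (at 0)"
            unfolding has_field_derivative_def
            by (rule has_derivative_eq_rhs)
              (simp add: fun_eq_iff mult.assoc[symmetric] sum_mult_axis, simp add: E_def algebra_simps)
          from DERIV_mult[OF kernel_squared_derivative[of y i] this]
          show ?thesis by (simp add: algebra_simps)
        qed
        show "continuous_on (cube 3) (\<lambda>y. (kernel y)\<^sup>2 * D i (z + r *\<^sub>R y))"
          by (intro continuous_intros D3)
        show "continuous_on (cube 3) (\<lambda>y. ?A i y + ?B i y)"
          by (intro continuous_intros D3 E3)
      qed (simp add: kernel_eq_0)
      then show ?thesis by (simp only: integral_add[OF A B])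
    qed
    have 1: "integral (cube 2) (\<lambda>y. kernel y * (\<Sum>i\<in>UNIV. D i (z + r *\<^sub>R y) * y $ i))
        = - (1 / 4) * (\<Sum>i\<in>UNIV. integral (cube 2) (?A i))"
    proof -
      have "integral (cube 2) (\<lambda>y. kernel y * (\<Sum>i\<in>UNIV. D i (z + r *\<^sub>R y) * y $ i))
          = integral (cube 2) (\<lambda>y. - (1 / 4) * (\<Sum>i\<in>UNIV. ?A i y))"
        by (rule arg_cong[of _ _ "integral _"]) (auto simp: fun_eq_iff sum_distrib_left algebra_simps)
      also have "\<dots> = - (1 / 4) * integral (cube 2) (\<lambda>y. \<Sum>i\<in>UNIV. ?A i y)" by (rule integral_mult_right)
      finally show ?thesis using A by (simp add: integral_sum)
    qed
    have eq: "(\<lambda>y. (kernel y)\<^sup>2 * (r * laplacian g (z + r *\<^sub>R y))) = (\<lambda>y. \<Sum>i\<in>UNIV. ?B i y)"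
      by (simp add: fun_eq_iff sum_distrib_left laplacian_def E_def D_def)
    have 2: "(\<Sum>i\<in>UNIV. integral (cube 2) (?B i))
        = integral (cube 2) (\<lambda>y. (kernel y)\<^sup>2 * (r * laplacian g (z + r *\<^sub>R y)))"
      unfolding eq using B by (simp add: integral_sum)
    have "integral (cube 2) (\<lambda>y. (kernel y)\<^sup>2 * (r * laplacian g (z + r *\<^sub>R y))) \<ge> 0"
    proof (rule integral_nonneg)
      show "(\<lambda>y. (kernel y)\<^sup>2 * (r * laplacian g (z + r *\<^sub>R y))) integrable_on cube 2"
        unfolding eq by (intro integrable_sum B) simp
      show "0 \<le> (kernel y)\<^sup>2 * (r * laplacian g (z + r *\<^sub>R y))" if "y \<in> cube 2" for y
        using lap[OF zS[OF r subsetD[OF c23 that]]] r by simp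
    qed
    moreover have "(\<Sum>i\<in>UNIV. integral (cube 2) (?A i)) = - (\<Sum>i\<in>UNIV. integral (cube 2) (?B i))"
      using AB by (simp add: sum_negf[symmetric] eq_neg_iff_add_eq_0)
    ultimately show ?thesis using 1 2 by simp
  qed
  have "J 0 \<le> J \<rho>"
  proof (rule DERIV_nonneg_imp_increasing_open[OF \<rho>(1)])
    show "\<exists>y. (J has_real_derivative y) (at r) \<and> 0 \<le> y" if "0 < r" "r < \<rho>" for r
      using J'[of r] pos[of r] that by (auto simp: at_within_Icc_at)
    show "continuous_on {0..\<rho>} J"
      by (rule DERIV_continuous_on[OF J'])
  qed
  moreover have "J 0 = g z * integral (cube 2) (kernel :: real ^ 'n \<Rightarrow> real)" by (simp add: J_def mult.commute)
  ultimately show ?thesis by (simp add: J_def mult.commute[of "g z"])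
qed

lemma integral_kernel_pos: "integral (cube 2) (kernel :: real ^ 'n::finite \<Rightarrow> real) > 0"
proof -
  have c: "continuous_on (cube 2) (kernel :: real ^ 'n \<Rightarrow> real)" by (intro continuous_intros)
  then have i: "(kernel :: real ^ 'n \<Rightarrow> real) integrable_on cube 2" by (rule integrable_continuous)
  have "integral (cube 2) (kernel :: real ^ 'n \<Rightarrow> real) \<noteq> 0"
  proof
    assume "integral (cube 2) (kernel :: real ^ 'n \<Rightarrow> real) = 0"
    then have "(kernel has_integral 0) (cube 2 :: (real ^ 'n) set)"
      using i by (metis integrable_integral)
    then have "kernel (0 :: real ^ 'n) = 0"
      by (rule has_integral_0_cbox_imp_0[OF c kernel_nonneg]) (auto simp: mem_cube interval_ne_empty_cart mem_box_cart)
    then show False by (simp add: kernel_def)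
  qed
  moreover have "integral (cube 2) (kernel :: real ^ 'n \<Rightarrow> real) \<ge> 0"
    by (rule integral_nonneg[OF i]) (simp add: kernel_nonneg)
  ultimately show ?thesis by linarith
qed

text \<open>Up to normalisation, \<open>p z\<close> is at most the mean of \<open>p\<close>, hence
  of \<open>P\<close>, on scale \<open>\<rho>\<close> about \<open>z\<close>, and the mean of
  \<open>P\<close> on scale \<open>4 * \<rho>\<close> about \<open>y\<close> is at most
  \<open>P y\<close>. As \<open>P \<ge> 0\<close>, the second mean controls the first:
  \<open>4 ^ CARD('n)\<close> is the ratio of volumes and 2 the loss in the kernel.\<close>

lemma sub_super_harnack:
  fixes p P :: "real ^ 'n::finite \<Rightarrow> real" and k :: 'n
  assumes p: "C2_on (half_space k) p" "\<And>x. x \<in> half_space k \<Longrightarrow> laplacian p x \<ge> 0"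
    and P: "C2_on (half_space k) P" "\<And>x. x \<in> half_space k \<Longrightarrow> laplacian P x \<le> 0"
    and le: "\<And>x. x \<in> half_space k \<Longrightarrow> p x \<le> P x" "\<And>x. x \<in> half_space k \<Longrightarrow> P x \<ge> 0"
    and z: "z \<in> half_space k" and y: "dist z y \<le> z $ k / 16"
  shows "p z \<le> 2 * 4 ^ CARD('n) * P y"
proof -
  \<comment> \<open>The divisor 16 leaves \<open>y\<close> at depth at least
    \<open>15 * \<rho>\<close>, so the cube of half-width \<open>12 * \<rho>\<close> about it,
    needed for the mean on scale \<open>4 * \<rho>\<close>, stays in the half space.\<close>
  define \<rho> where "\<rho> = z $ k / 16"
  have \<rho>: "\<rho> > 0" using z by (simp add: \<rho>_def half_space_def)
  have yk: "y $ k \<ge> 15 * \<rho>"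
    using component_le_norm_cart[of "z - y" k] y by (simp add: dist_norm \<rho>_def)
  have inH: "x + r *\<^sub>R \<eta> \<in> half_space k" if "\<eta> \<in> cube 3" "r \<ge> 0" "x $ k > 3 * r" for x r \<eta>
  proof -
    have "- 3 \<le> \<eta> $ k" using that(1)[unfolded mem_cube, rule_format, of k] by linarith
    from mult_left_mono[OF this that(2)] show ?thesis using that(3) by (simp add: half_space_def)
  qed
  have zH: "z + \<rho> *\<^sub>R \<eta> \<in> half_space k" if "\<eta> \<in> cube 3" for \<eta>
    using that \<rho> by (intro inH) (auto simp: \<rho>_def)
  have yH: "y + (4 * \<rho>) *\<^sub>R \<eta> \<in> half_space k" if "\<eta> \<in> cube 3" for \<eta>
    using that \<rho> yk by (intro inH) auto
  let ?K = "integral (cube 2) (kernel :: real ^ 'n \<Rightarrow> real)"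
  have contH: "continuous_on (half_space k) f" if "C2_on (half_space k) f" for f :: "real ^ 'n \<Rightarrow> real"
    using C2_on_derivs(1)[OF that] by (meson continuous_at_imp_continuous_on has_derivative_continuous)
  note pc = contH[OF p(1)] and Pc = contH[OF P(1)]
  have c23: "cube 2 \<subseteq> (cube 3 :: (real ^ 'n) set)" and c12: "cube 1 \<subseteq> (cube 2 :: (real ^ 'n) set)"
    by (auto intro!: cube_mono)
  define f where "f = (\<lambda>\<eta>. kernel \<eta> * P (y + (4 * \<rho>) *\<^sub>R \<eta>))"
  have fc: "continuous_on (cube 2) f"
    unfolding f_def using yH c23 by (intro continuous_intros continuous_on_compose2[OF Pc]) auto
  define h where "h = (\<lambda>\<xi>. kernel \<xi> * P (z + \<rho> *\<^sub>R \<xi>))"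
  have hc: "continuous_on (cube 2) h"
    unfolding h_def using zH c23 by (intro continuous_intros continuous_on_compose2[OF Pc]) auto
  have "p z * ?K \<le> integral (cube 2) (\<lambda>\<xi>. kernel \<xi> * p (z + \<rho> *\<^sub>R \<xi>))"
    by (rule mean_value_subharmonic[OF open_half_space p]) (use \<rho> zH in auto)
  also have "\<dots> \<le> integral (cube 2) h"
  proof (rule integral_le)
    show "(\<lambda>\<xi>. kernel \<xi> * p (z + \<rho> *\<^sub>R \<xi>)) integrable_on cube 2"
      using zH c23 by (intro integrable_continuous continuous_intros continuous_on_compose2[OF pc]) auto
    show "kernel \<xi> * p (z + \<rho> *\<^sub>R \<xi>) \<le> h \<xi>" if "\<xi> \<in> cube 2" for \<xi>
      unfolding h_def using le(1) zH c23 that by (intro mult_left_mono) (auto simp: kernel_nonneg)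
  qed (rule integrable_continuous[OF hc])
  also have "\<dots> = integral (cube 1) h"
  proof -
    have "(h has_integral integral (cube 1) h) (cube 2)"
    proof (rule has_integral_on_superset[OF integrable_integral _ c12])
      show "h integrable_on cube 1" by (rule integrable_continuous, rule continuous_on_subset[OF hc c12])
      show "h \<xi> = 0" if "\<xi> \<notin> cube 1" for \<xi>
      proof -
        from that obtain j where "1 < \<bar>\<xi> $ j\<bar>" by (auto simp: mem_cube not_le)
        then have "1 \<le> norm \<xi>" using component_le_norm_cart[of \<xi> j] by linarith
        then show ?thesis by (simp add: h_def kernel_eq_0)
      qed
    qed
    then show ?thesis by (rule integral_unique)
  qed
  finally have 1: "p z * ?K \<le> integral (cube 1) h" .
  \<comment> \<open>In the coordinate \<open>\<eta>\<close> of
    \<open>y + (4 * \<rho>) *\<^sub>R \<eta>\<close> the point \<open>z\<close> is \<open>c\<close>,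
    and \<open>cbox a b\<close> below is the cube of half-width \<open>\<rho>\<close> about
    \<open>z\<close>.\<close>
  define c where "c = (1 / (4 * \<rho>)) *\<^sub>R (z - y)"
  have c: "norm c \<le> 1 / 4"
  proof -
    have "norm c = dist z y / (4 * \<rho>)" using \<rho> unfolding c_def norm_scaleR dist_norm by simp
    also have "\<dots> \<le> \<rho> / (4 * \<rho>)" using y \<rho> by (intro divide_right_mono) (auto simp: \<rho>_def)
    finally show ?thesis using \<rho> by simp
  qed
  define a b where "a = (1 / 4) *\<^sub>R (\<chi> i. - 1) + c" and "b = (1 / 4) *\<^sub>R (\<chi> i. 1) + c"
  have ab: "cbox a b \<subseteq> cube 2"
  proof
    fix \<eta> assume "\<eta> \<in> cbox a b"
    then have \<eta>: "- 1 / 4 + c $ j \<le> \<eta> $ j" "\<eta> $ j \<le> 1 / 4 + c $ j" for j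
      by (auto simp: mem_box_cart a_def b_def)
    have "\<bar>\<eta> $ j\<bar> \<le> 2" for j
      using \<eta>[of j] c component_le_norm_cart[of c j] by linarith
    then show "\<eta> \<in> cube 2" by (simp add: mem_cube)
  qed
  define I where "I = integral (cbox a b) f"
  have "(f has_integral I) (cbox a b)"
    unfolding I_def by (rule integrable_integral, rule integrable_continuous, rule continuous_on_subset[OF fc ab])
  then have *: "((\<lambda>\<xi>. f ((1 / 4) *\<^sub>R \<xi> + c)) has_integral I /\<^sub>R (1 / 4) ^ DIM(real ^ 'n))
      (cbox ((a - c) /\<^sub>R (1 / 4)) ((b - c) /\<^sub>R (1 / 4)))"
    by (subst has_integral_affinity_iff) simp_all
  then have I: "((\<lambda>\<xi>. f ((1 / 4) *\<^sub>R \<xi> + c)) has_integral 4 ^ CARD('n) * I) (cube 1)"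
  proof -
    have "(a - c) /\<^sub>R (1 / 4) = (\<chi> i. - 1)" "(b - c) /\<^sub>R (1 / 4) = (\<chi> i. 1)"
      by (simp_all add: a_def b_def vec_eq_iff)
    moreover have "I /\<^sub>R (1 / 4) ^ DIM(real ^ 'n) = 4 ^ CARD('n) * I"
      by (simp add: power_one_over)
    ultimately show ?thesis using * by (simp only:)
  qed
  have f2: "f ((1 / 4) *\<^sub>R \<xi> + c) \<ge> 1 / 2 * h \<xi>" if \<xi>: "\<xi> \<in> cube 1" for \<xi>
  proof -
    have eq: "y + (4 * \<rho>) *\<^sub>R ((1 / 4) *\<^sub>R \<xi> + c) = z + \<rho> *\<^sub>R \<xi>"
      using \<rho> by (simp add: c_def scaleR_add_right)
    \<comment> \<open>For \<open>norm \<xi> < 1\<close> the argument on the right has norm at most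
      \<open>1 / 4 + 1 / 4\<close>, which keeps the kernel above \<open>1 / 2\<close>; otherwise the
      left side is 0.\<close>
    have "1 / 2 * kernel \<xi> \<le> kernel ((1 / 4) *\<^sub>R \<xi> + c)"
    proof (cases "norm \<xi> < 1")
      case True
      have "norm ((1 / 4) *\<^sub>R \<xi> + c) \<le> 1 / 4 * norm \<xi> + norm c"
        by (rule order_trans[OF norm_triangle_ineq]) simp
      also have "\<dots> \<le> 1 / 2" using True c by linarith
      finally have "(norm ((1 / 4) *\<^sub>R \<xi> + c))\<^sup>2 \<le> (1 / 2)\<^sup>2" by (intro power_mono) auto
      then have "kernel ((1 / 4) *\<^sub>R \<xi> + c) \<ge> 1 / 2"
        unfolding kernel_def power2_norm_eq_inner by (simp add: power2_eq_square)
      moreover have "kernel \<xi> \<le> 1" by (simp add: kernel_def)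
      ultimately show ?thesis by linarith
    next
      case False
      then show ?thesis using kernel_eq_0[of \<xi>] kernel_nonneg[of "(1 / 4) *\<^sub>R \<xi> + c"] by simp
    qed
    from mult_right_mono[OF this le(2)[OF zH]] show ?thesis
      using \<xi> c12 c23 unfolding f_def h_def eq by (auto simp: mult.assoc)
  qed
  have "1 / 2 * integral (cube 1) h \<le> 4 ^ CARD('n) * I"
  proof -
    have "((\<lambda>\<xi>. 1 / 2 * h \<xi>) has_integral 1 / 2 * integral (cube 1) h) (cube 1)"
      by (intro has_integral_mult_right integrable_integral integrable_continuous continuous_on_subset[OF hc c12])
    from has_integral_le[OF this I f2] show ?thesis .
  qed
  moreover have "I \<le> integral (cube 2) f"
    unfolding I_def
    by (rule integral_subset_le[OF ab])
      (use le(2) yH c23 in \<open>auto intro!: integrable_continuous fc continuous_on_subset[OF fc ab] mult_nonneg_nonneg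
        simp: f_def[THEN fun_cong] kernel_nonneg\<close>)
  moreover have "integral (cube 2) f \<le> P y * ?K"
  proof -
    \<comment> \<open>Superharmonicity of \<open>P\<close> enters as subharmonicity of its negative;
      the term \<open>0 * P x\<close> merely fits the form of a linear combination.\<close>
    have Q: "C2_on (half_space k) (\<lambda>x. (- 1) * P x + 0 * P x)"
      "\<And>x. x \<in> half_space k \<Longrightarrow> laplacian (\<lambda>x. (- 1) * P x + 0 * P x) x \<ge> 0"
      using C2_on_lincomb[OF open_half_space P(1) P(1), where a = "- 1" and b = 0] P(2) by auto
    have "((- 1) * P y + 0 * P y) * ?K
        \<le> integral (cube 2) (\<lambda>\<eta>. kernel \<eta> * ((- 1) * P (y + (4 * \<rho>) *\<^sub>R \<eta>) + 0 * P (y + (4 * \<rho>) *\<^sub>R \<eta>)))"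
      by (rule mean_value_subharmonic[OF open_half_space Q]) (use \<rho> yH in auto)
    then show ?thesis by (simp add: f_def)
  qed
  ultimately have "1 / 2 * integral (cube 1) h \<le> 4 ^ CARD('n) * (P y * ?K)"
    by (meson mult_left_mono order_trans zero_le_numeral zero_le_power)
  then have "p z * ?K \<le> 2 * 4 ^ CARD('n) * (P y * ?K)" using 1 by simp
  then have "p z * ?K \<le> (2 * 4 ^ CARD('n) * P y) * ?K" by (simp add: mult.assoc)
  then show ?thesis using integral_kernel_pos by (rule mult_right_le_imp_le)
qed

section \<open>A Liouville theorem\<close>

definition reflection :: "'n::finite \<Rightarrow> real ^ 'n \<Rightarrow> real ^ 'n" where
  "reflection k x = x - (2 * x $ k) *\<^sub>R axis k 1"

text \<open>The excess \<open>4 * x $ k * a $ k\<close> vanishes for \<open>x\<close> on the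
  boundary, where the two poles therefore cancel, and it is the source of the linear factor
  \<open>x $ k\<close> in the final lower bound.\<close>

lemma dist_reflection:
  fixes x a :: "real ^ 'n::finite"
  shows "(x - reflection k a) \<bullet> (x - reflection k a) = (x - a) \<bullet> (x - a) + 4 * x $ k * a $ k"
proof -
  have eq: "x - reflection k a = (x - a) + (2 * a $ k) *\<^sub>R axis k 1" by (simp add: reflection_def)
  have e: "axis k 1 \<bullet> (axis k 1 :: real ^ 'n) = 1" by (simp add: inner_axis_axis)
  have *: "(v + c *\<^sub>R axis k 1) \<bullet> (v + c *\<^sub>R axis k 1) = v \<bullet> v + 2 * c * v $ k + c\<^sup>2" for v :: "real ^ 'n" and c
    by (simp add: inner_add_left inner_add_right e inner_axis inner_axis' power2_eq_square distrib_left)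
  show ?thesis unfolding eq * by (simp add: algebra_simps power2_eq_square)
qed

text \<open>
  The comparison function is \<open>|y - a|\<^sup>-\<^sup>2\<^sup>d - |y - a'|\<^sup>-\<^sup>2\<^sup>d\<close> with \<open>a'\<close> the mirror image of \<open>a\<close>: it
  vanishes on the boundary and is strictly subharmonic on the half space, where \<open>a\<close> is the closer pole.
\<close>

lemma superharmonic_lower_bound:
  fixes P :: "real ^ 'n::finite \<Rightarrow> real" and k :: 'n
  defines "d \<equiv> CARD('n)"
  assumes P: "C2_on (half_space k) P" "continuous_on (closure (half_space k)) P"
    and lap: "\<And>y. y \<in> half_space k \<Longrightarrow> laplacian P y \<le> 0"
    and nonneg: "\<And>y. y \<in> closure (half_space k) \<Longrightarrow> P y \<ge> 0"
    and a: "a \<in> half_space k" and s: "s > 0" "m > 0"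
    and ball: "\<And>y. y \<in> half_space k \<Longrightarrow> dist a y \<le> s \<Longrightarrow> P y \<ge> m"
    and x: "x \<in> half_space k" "dist a x > s"
  shows "P x \<ge> m * (s\<^sup>2) ^ d * (1 / ((x - a) \<bullet> (x - a)) ^ d
    - 1 / ((x - reflection k a) \<bullet> (x - reflection k a)) ^ d)"
proof -
  define a' where "a' = reflection k a"
  define g where "g = (\<lambda>y. 1 / ((y - a) \<bullet> (y - a)) ^ d)"
  define g' where "g' = (\<lambda>y. 1 / ((y - a') \<bullet> (y - a')) ^ d)"
  \<comment> \<open>Normalised so that \<open>c * g\<close> equals \<open>m\<close> on the sphere of
    radius \<open>s\<close> about \<open>a\<close>.\<close>
  define c where "c = m * (s\<^sup>2) ^ d"
  have d: "d \<ge> 1" by (simp add: d_def Suc_leI)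
  have c: "c > 0" using s by (simp add: c_def)
  have ak: "a $ k > 0" using a by (simp add: half_space_def)
  have a': "a' $ k = - a $ k" by (simp add: a'_def reflection_def)
  have q': "(y - a') \<bullet> (y - a') = (y - a) \<bullet> (y - a) + 4 * y $ k * a $ k" for y
    unfolding a'_def by (rule dist_reflection)
  \<comment> \<open>Comparison takes place between the radii \<open>s\<close> and \<open>R\<close>
    about \<open>a\<close>. The subtracted constant is the value of \<open>c * g\<close> on the
    outer sphere, so \<open>P \<ge> 0\<close> suffices there; it disappears as \<open>R\<close>
    tends to infinity.\<close>
  have bound: "c * (g x - g' x) - c / (R\<^sup>2) ^ d \<le> P x" if R: "R > dist a x" for R
  proof -
    define S where "S = half_space k \<inter> (ball a R - cball a s)"
    have Sop: "open S" "bounded S"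
      by (auto simp: S_def intro!: open_Int open_Diff open_half_space bounded_Int bounded_diff)
    have "R > 0" using R zero_le_dist[of a x] by linarith
    have SH: "S \<subseteq> half_space k" by (auto simp: S_def)
    have aS: "a \<notin> S" "a' \<notin> S" using s a' ak by (auto simp: S_def half_space_def)
    have "closed ({y :: real ^ 'n. y $ k \<ge> 0} \<inter> (cball a R - ball a s))"
      unfolding closure_half_space[symmetric] by (intro closed_Int closed_closure closed_Diff closed_cball open_ball)
    moreover have "S \<subseteq> {y. y $ k \<ge> 0} \<inter> (cball a R - ball a s)" by (auto simp: S_def half_space_def)
    ultimately have Scl: "closure S \<subseteq> {y. y $ k \<ge> 0} \<inter> (cball a R - ball a s)"
      by (rule closure_minimal[rotated])
    have Sfr: "y $ k = 0 \<or> dist a y = R \<or> (y \<in> half_space k \<and> dist a y = s)" if "y \<in> frontier S" for y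
    proof -
      have "y \<in> closure S" "y \<notin> S"
        using that by (simp_all add: frontier_def interior_open[OF Sop(1)])
      then show ?thesis using Scl by (auto simp: S_def half_space_def)
    qed
    have qs: "(y - a) \<bullet> (y - a) \<ge> s\<^sup>2" "(y - a') \<bullet> (y - a') \<ge> (y - a) \<bullet> (y - a)"
      "g' y \<le> g y" "g y > 0" "g' y > 0" if "y \<in> closure S" for y
    proof -
      have y: "y $ k \<ge> 0" "dist a y \<ge> s" using that Scl by auto
      show 1: "(y - a) \<bullet> (y - a) \<ge> s\<^sup>2"
        using y(2) s power_mono[of s "norm (y - a)" 2]
        by (simp add: dist_norm norm_minus_commute[of a y] power2_norm_eq_inner)
      show 2: "(y - a') \<bullet> (y - a') \<ge> (y - a) \<bullet> (y - a)"
        unfolding q' using y ak by simp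
      have pos: "(y - a) \<bullet> (y - a) > 0" using 1 s by (smt (verit) zero_less_power)
      then show "g y > 0" by (simp add: g_def del: inner_gt_zero_iff)
      show "g' y > 0" using pos 2 unfolding g'_def by (intro divide_pos_pos zero_less_power) linarith+
      show "g' y \<le> g y" unfolding g_def g'_def using pos 2
        by (intro divide_left_mono power_mono mult_pos_pos zero_less_power) linarith+
    qed
    define W where "W = (\<lambda>y. 1 * (c * g y + (- c) * g' y) + 1 * ((- 1) * P y + (- c / (R\<^sup>2) ^ d) * 1))"
    note g2 = C2_on_inverse_power[OF Sop(1) aS(1), where m = d, folded g_def]
    note g'2 = C2_on_inverse_power[OF Sop(1) aS(2), where m = d, folded g'_def]
    note c2 = C2_on_const[OF Sop(1), where c = 1]
    note 1 = C2_on_lincomb[OF Sop(1) g2(1) g'2(1), where a = c and b = "- c"]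
    note 2 = C2_on_lincomb[OF Sop(1) C2_on_subset[OF P(1) SH] c2(1), where a = "- 1" and b = "- c / (R\<^sup>2) ^ d"]
    note W2 = C2_on_lincomb[OF Sop(1) 1(1) 2(1), where a = 1 and b = 1, folded W_def]
    have lapW: "laplacian W y > 0" if y: "y \<in> S" for y
    proof -
      have ycl: "y \<in> closure S" using y closure_subset by blast
      have yk: "y $ k > 0" using y by (auto simp: S_def half_space_def)
      have lt: "(y - a) \<bullet> (y - a) < (y - a') \<bullet> (y - a')" unfolding q' using yk ak by simp
      have pos: "(y - a) \<bullet> (y - a) > 0" using qs(1)[OF ycl] s by (smt (verit) zero_less_power)
      have e: "4 * real d * (real d + 1) - 2 * real d * real d > 0"
        using d by (simp add: algebra_simps add_pos_pos)
      have "laplacian g' y < laplacian g y"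
        unfolding g2(2)[OF y] g'2(2)[OF y] d_def[symmetric]
      proof (rule divide_strict_left_mono[OF _ e])
        show "((y - a) \<bullet> (y - a)) ^ (d + 1) < ((y - a') \<bullet> (y - a')) ^ (d + 1)"
          using lt pos by (intro power_strict_mono) auto
        show "0 < ((y - a') \<bullet> (y - a')) ^ (d + 1) * ((y - a) \<bullet> (y - a)) ^ (d + 1)"
          using lt pos by (intro mult_pos_pos zero_less_power) linarith+
      qed
      then have "c * laplacian g' y < c * laplacian g y" using c by simp
      moreover have "laplacian W y = c * laplacian g y - c * laplacian g' y - laplacian P y"
        using W2(2)[OF y] 1(2)[OF y] 2(2)[OF y] c2(2)[OF y] by simp
      ultimately show ?thesis using lap[of y] y SH by force
    qed
    have Wcont: "continuous_on (closure S) W"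
    proof -
      have "continuous_on (closure S) P"
        using continuous_on_subset[OF P(2) closure_mono[OF SH]] .
      moreover have "(y - a) \<bullet> (y - a) \<noteq> 0" "(y - a') \<bullet> (y - a') \<noteq> 0" if "y \<in> closure S" for y
        using qs(1,2)[OF that] s(1) by (smt (verit) zero_less_power)+
      ultimately show ?thesis unfolding W_def g_def g'_def
        by (intro continuous_intros) (auto simp: power_eq_0_iff)
    qed
    have Wbd: "W y \<le> 0" if "y \<in> frontier S" for y
    proof -
      have y: "y \<in> closure S" using that by (simp add: frontier_def)
      then have "y \<in> closure (half_space k)" using closure_mono[OF SH] by blast
      then have Py: "P y \<ge> 0" by (rule nonneg)
      have R2: "c / (R\<^sup>2) ^ d \<ge> 0" using c by simp
      have W: "W y = c * g y - c * g' y - P y - c / (R\<^sup>2) ^ d" by (simp add: W_def)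
      have g'0: "c * g' y \<ge> 0" using qs(5)[OF y] c by simp
      from Sfr[OF that] consider "y $ k = 0" | "dist a y = R" | "y \<in> half_space k" "dist a y = s" by blast
      then show ?thesis
      proof cases
        case 1
        then have "g' y = g y" by (simp add: g_def g'_def q')
        then show ?thesis using Py R2 W by simp
      next
        case 2
        have "(y - a) \<bullet> (y - a) = R\<^sup>2"
          using 2 by (simp add: dist_norm norm_minus_commute power2_norm_eq_inner[symmetric])
        then have "c * g y = c / (R\<^sup>2) ^ d" by (simp add: g_def)
        then show ?thesis using W Py g'0 by linarith
      next
        case 3
        have "(y - a) \<bullet> (y - a) = s\<^sup>2"
          using 3 by (simp add: dist_norm norm_minus_commute power2_norm_eq_inner[symmetric])
        then have "c * g y = m" using s by (simp add: g_def c_def)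
        moreover have "P y \<ge> m" using ball 3 by simp
        ultimately show ?thesis using W R2 g'0 by linarith
      qed
    qed
    have "x \<in> S" using x R by (simp add: S_def)
    then have "W x \<le> 0"
      using strict_maximum_principle[OF Sop W2(1) Wcont lapW Wbd] closure_subset by blast
    then show ?thesis by (simp add: W_def algebra_simps)
  qed
  have "((\<lambda>R. c * (g x - g' x) - c / (R\<^sup>2) ^ d) \<longlongrightarrow> c * (g x - g' x) - 0) at_top"
    using d by (intro tendsto_intros tendsto_divide_0[OF tendsto_const] filterlim_at_top_imp_at_infinity
        filterlim_pow_at_top filterlim_ident) auto
  moreover have "\<forall>\<^sub>F R in at_top. c * (g x - g' x) - c / (R\<^sup>2) ^ d \<le> P x"
    by (intro eventually_mono[OF eventually_gt_at_top[of "dist a x"]] bound)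
  ultimately have "c * (g x - g' x) - 0 \<le> P x"
    by (intro tendsto_upperbound) auto
  then show ?thesis by (simp add: c_def g_def g'_def a'_def)
qed

text \<open>The right side is \<open>((\<beta> / \<alpha>) ^ d - 1) / \<beta> ^ d\<close>, and a
  number that is at least 1 is at most its \<open>d\<close>-th power. With \<open>\<alpha>\<close>
  and \<open>\<beta>\<close> the squared distances to a pole and to its mirror image, the difference
  of poles gets a lower bound linear in \<open>x $ k\<close>.\<close>

lemma inverse_power_diff_ge:
  fixes \<alpha> \<beta> Q :: real
  assumes "0 < \<alpha>" "\<alpha> \<le> \<beta>" "\<beta> \<le> Q" "d \<ge> 1"
  shows "(\<beta> - \<alpha>) / Q ^ (d + 1) \<le> 1 / \<alpha> ^ d - 1 / \<beta> ^ d"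
proof -
  have pos: "\<beta> > 0" "Q > 0" using assms by auto
  have "(\<beta> - \<alpha>) / Q ^ (d + 1) = 1 / Q ^ d * ((\<beta> - \<alpha>) / Q)" by simp
  also have "\<dots> \<le> 1 / \<beta> ^ d * ((\<beta> - \<alpha>) / \<alpha>)"
    using assms pos by (intro mult_mono divide_left_mono power_mono) auto
  also have "(\<beta> - \<alpha>) / \<alpha> = \<beta> / \<alpha> - 1" using assms by (simp add: field_simps)
  also have "1 / \<beta> ^ d * (\<beta> / \<alpha> - 1) \<le> 1 / \<beta> ^ d * ((\<beta> / \<alpha>) ^ d - 1)"
    using assms pos self_le_power[of "\<beta> / \<alpha>" d] by (intro mult_left_mono) auto
  also have "\<dots> = 1 / \<alpha> ^ d - 1 / \<beta> ^ d" using pos by (simp add: power_divide field_simps)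
  finally show ?thesis .
qed

text \<open>
  If \<open>p e > 0\<close>, let \<open>a\<close> maximise \<open>(R - dist z y)\<^sup>n * p y\<close> over the half ball of radius \<open>R\<close>. The weight
  keeps \<open>p\<close> comparable to \<open>p a\<close> near \<open>a\<close>, so the boundary growth estimate forces \<open>a\<close> to have depth
  at least a fixed multiple of \<open>r = R - dist z a\<close>; Harnack then bounds \<open>P\<close> from below near \<open>a\<close>. The
  exponent \<open>n = 2 d + 1\<close> makes the powers of \<open>r\<close> cancel in the resulting bound \<open>c * x $ k \<le> P x\<close>,
  so that \<open>c\<close> does not depend on \<open>R\<close>.
\<close>

lemma sub_super_liouville_half_space:
  fixes p P :: "real ^ 'n::finite \<Rightarrow> real" and k :: 'n
  assumes p: "C2_on (half_space k) p" "continuous_on (closure (half_space k)) p"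
      "\<And>x. x \<in> half_space k \<Longrightarrow> laplacian p x \<ge> 0"
    and p0: "\<And>x. x \<in> closure (half_space k) \<Longrightarrow> p x \<ge> 0" "\<And>x. x \<in> frontier (half_space k) \<Longrightarrow> p x = 0"
    and P: "C2_on (half_space k) P" "continuous_on (closure (half_space k)) P"
      "\<And>x. x \<in> half_space k \<Longrightarrow> laplacian P x \<le> 0" "\<And>x. x \<in> closure (half_space k) \<Longrightarrow> P x \<ge> 0"
    and le: "\<And>x. x \<in> half_space k \<Longrightarrow> p x \<le> P x"
    and inf: "\<And>\<epsilon>. \<epsilon> > 0 \<Longrightarrow> \<exists>x\<in>half_space k. P x < \<epsilon> * x $ k"
    and e: "e \<in> half_space k"
  shows "p e = 0"
proof (rule ccontr)
  assume "p e \<noteq> 0"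
  have HC: "half_space k \<subseteq> closure (half_space k)" by (rule closure_subset)
  have pe: "p e > 0" using \<open>p e \<noteq> 0\<close> p0(1)[of e] e HC by force
  have ek: "e $ k > 0" using e by (simp add: half_space_def)
  define d where "d = CARD('n)"
  define n where "n = 2 * d + 1"
  have d: "d \<ge> 1" by (simp add: d_def Suc_leI)
  define z where "z = e - e $ k *\<^sub>R axis k 1"
  have zk: "z $ k = 0" by (simp add: z_def)
  \<comment> \<open>The growth estimate at \<open>a\<close> with radius \<open>r / 4\<close>, where
    \<open>p\<close> is at most \<open>2 ^ n * p a\<close>, reads
    \<open>p a \<le> 16 d 2^n (t / r) * p a\<close>; so \<open>t / r\<close> cannot be smaller than
    this number.\<close>
  define \<epsilon> where "\<epsilon> = 1 / (16 * real d * 2 ^ n)"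
  have \<epsilon>: "\<epsilon> > 0" using d by (simp add: \<epsilon>_def)
  have "16 * real d * 2 ^ n \<ge> 4 * 1 * 1" using d by (intro mult_mono) auto
  then have \<epsilon>4: "\<epsilon> \<le> 1 / 4" unfolding \<epsilon>_def by (intro divide_left_mono) (auto simp: mult_pos_pos)
  \<comment> \<open>The constant left when the growth estimate at \<open>e\<close> with radius
    \<open>R / 2\<close> is solved for \<open>p a\<close>.\<close>
  define A where "A = p e / e $ k / (8 * real d * 2 ^ n)"
  have A: "A > 0" using pe ek d by (simp add: A_def)
  define C :: real where "C = 2 * 4 ^ d"
  have C: "C > 0" by (simp add: C_def)
  \<comment> \<open>Numerical factors of the final chain: \<open>16 ^ (2 * d)\<close> from
    \<open>s = t / 16\<close>, \<open>4 ^ (d + 1)\<close> from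
    \<open>\<beta> \<le> 4 * R\<^sup>2\<close>, and 4 from
    \<open>\<beta> - \<alpha> = 4 * x $ k * t\<close>.\<close>
  define B :: real where "B = 4 / (16 ^ (2 * d) * 4 ^ (d + 1))"
  have B: "0 < B" by (simp add: B_def)
  have B1: "B \<le> 1"
  proof -
    have "(4::real) * 1 \<le> 4 ^ (d + 1) * 16 ^ (2 * d)"
      using self_le_power[of "4::real" "d + 1"] by (intro mult_mono) auto
    then show ?thesis by (simp add: B_def field_simps)
  qed
  define c where "c = A / C * \<epsilon> ^ n * B"
  have c: "c > 0" using A C \<epsilon> B by (simp add: c_def)
  have lower: "c * x $ k \<le> P x" if R: "R > 2 * e $ k" and x: "x \<in> half_space k" "dist z x < R" for R x
  proof -
    have R0: "R > 0" using R ek by linarith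
    define K where "K = closure (half_space k) \<inter> cball z R"
    define \<phi> where "\<phi> = (\<lambda>y. (R - dist z y) ^ n * p y)"
    have "dist z e = e $ k" using ek by (simp add: z_def dist_norm)
    then have eK: "e \<in> K" "\<phi> e > 0" using e HC pe R ek by (auto simp: K_def \<phi>_def)
    have "compact K" unfolding K_def by (intro closed_Int_compact closed_closure compact_cball)
    moreover have "continuous_on K \<phi>"
      unfolding \<phi>_def by (intro continuous_intros continuous_on_subset[OF p(2)]) (auto simp: K_def)
    ultimately obtain a where a: "a \<in> K" "\<And>y. y \<in> K \<Longrightarrow> \<phi> y \<le> \<phi> a"
      using continuous_attains_sup[of K \<phi>] eK(1) by blast
    define r where "r = R - dist z a"
    define t where "t = a $ k"
    have \<phi>a: "\<phi> a = r ^ n * p a" "\<phi> a > 0" using a(2)[OF eK(1)] eK(2) by (auto simp: \<phi>_def r_def)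
    have acl: "a \<in> closure (half_space k)" using a(1) by (simp add: K_def)
    have r: "r > 0" "r \<le> R" and pa: "p a > 0"
    proof -
      have "r \<ge> 0" using a(1) by (simp add: K_def r_def)
      moreover have "r \<noteq> 0" "p a \<noteq> 0" using \<phi>a by (auto simp: n_def)
      ultimately show "r > 0" "r \<le> R" "p a > 0" using p0(1)[OF acl] by (auto simp: r_def)
    qed
    have t: "t > 0" using acl p0(2)[of a] pa
      by (auto simp: t_def closure_half_space frontier_half_space less_le)
    then have aH: "a \<in> half_space k" by (simp add: half_space_def t_def)
    \<comment> \<open>Maximality of \<open>a\<close> for the weighted function: at distance at least
      \<open>\<sigma>\<close> from the sphere of radius \<open>R\<close>, the weight is at least
      \<open>\<sigma> ^ n\<close>, while at \<open>a\<close> it is \<open>r ^ n\<close>.\<close>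
    have pmax: "p y \<le> (r / \<sigma>) ^ n * p a" if y: "y \<in> closure (half_space k)" "dist z y \<le> R - \<sigma>" "\<sigma> > 0" for y \<sigma>
    proof -
      have "\<sigma> ^ n * p y \<le> (R - dist z y) ^ n * p y"
        using y p0(1)[OF y(1)] by (intro mult_right_mono power_mono) auto
      also have "\<dots> \<le> r ^ n * p a" using a(2)[of y, unfolded \<phi>a(1)] y by (simp add: K_def \<phi>_def)
      finally show ?thesis using y(3) by (simp add: power_divide field_simps)
    qed
    have "p e \<le> 4 * real CARD('n) * ((r / (R / 2)) ^ n * p a) * e $ k / (R / 2)"
    proof (rule subharmonic_boundary_growth[OF p(1,2)])
      show "0 < (r / (R / 2)) ^ n * p a" using r R0 pa by simp
      show "p y \<le> (r / (R / 2)) ^ n * p a"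
        if "y \<in> closure (half_space k)" "dist (e - e $ k *\<^sub>R axis k 1) y \<le> R / 2" for y
        using that R0 by (intro pmax) (auto simp: z_def)
    qed (use p p0 e R in auto)
    then have pa_ge: "A * R ^ (n + 1) / r ^ n \<le> p a"
      using ek R0 r d by (simp add: A_def power_divide power_mult_distrib d_def[symmetric] field_simps)
    have t_ge: "\<epsilon> * r \<le> t"
    proof (rule ccontr)
      assume "\<not> ?thesis"
      then have lt: "t < \<epsilon> * r" by simp
      have "\<epsilon> * r \<le> 1 / 4 * r" using \<epsilon>4 r by (intro mult_right_mono) auto
      then have t4: "t \<le> r / 4" using lt by linarith
      have "p a \<le> 4 * real CARD('n) * ((r / (r / 2)) ^ n * p a) * a $ k / (r / 4)"
      proof (rule subharmonic_boundary_growth[OF p(1,2)])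
        show "0 < (r / (r / 2)) ^ n * p a" using r pa by simp
        show "p y \<le> (r / (r / 2)) ^ n * p a"
          if y: "y \<in> closure (half_space k)" "dist (a - a $ k *\<^sub>R axis k 1) y \<le> r / 4" for y
        \<comment> \<open>Such \<open>y\<close> lie within \<open>t + r / 4 \<le> r / 2\<close> of
          \<open>a\<close>, which leaves the margin \<open>\<sigma> = r / 2\<close> to the sphere of
          radius \<open>R\<close>.\<close>
        proof (rule pmax[OF y(1)])
          have "dist a (a - a $ k *\<^sub>R axis k 1) = t" using t by (simp add: dist_norm t_def)
          then have "dist z y \<le> dist z a + t + r / 4"
            using y(2) dist_triangle[of z y a] dist_triangle[of a y "a - a $ k *\<^sub>R axis k 1"] by linarith
          moreover have "dist z a = R - r" by (simp add: r_def)
          ultimately show "dist z y \<le> R - r / 2" using t4 by linarith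
        qed (use r in simp)
      qed (use p p0 aH t4 in \<open>auto simp: t_def\<close>)
      then have "p a * (\<epsilon> * r) \<le> p a * t"
        using r d by (simp add: \<epsilon>_def t_def d_def[symmetric] field_simps)
      then show False using lt pa by simp
    qed
    define m where "m = p a / C"
    have m: "m > 0" using pa C by (simp add: m_def)
    have m_ge: "A / C * R ^ (n + 1) / r ^ n \<le> m"
      using pa_ge C by (simp add: m_def field_simps)
    define s where "s = t / 16"
    have s: "s > 0" using t by (simp add: s_def)
    have ball: "m \<le> P y" if "y \<in> half_space k" "dist a y \<le> s" for y
    proof -
      have "p a \<le> C * P y"
        unfolding C_def d_def
        by (rule sub_super_harnack[OF p(1,3) P(1,3) le P(4) aH]) (use that HC in \<open>auto simp: s_def t_def\<close>)
      then show ?thesis using C by (simp add: m_def field_simps)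
    qed
    have xk: "x $ k > 0" using x by (simp add: half_space_def)
    show ?thesis
    proof (cases "dist a x \<le> s")
      \<comment> \<open>Harnack gives \<open>P x \<ge> m\<close> directly here. Since
        \<open>r \<le> R\<close>, \<open>m\<close> is at least \<open>A / C * R\<close>, and
        \<open>x $ k \<le> R\<close>.\<close>
      case True
      have "x $ k = (x - z) $ k" by (simp add: zk)
      also have "\<dots> \<le> norm (x - z)" using component_le_norm_cart[of "x - z" k] by linarith
      also have "\<dots> \<le> R" using x(2) by (simp add: dist_norm norm_minus_commute)
      finally have xR: "x $ k \<le> R" .
      have "c \<le> A / C * 1 * 1"
        unfolding c_def using A C \<epsilon> \<epsilon>4 B B1 by (intro mult_mono power_le_one) auto
      then have "c * x $ k \<le> A / C * R" using xR xk A C by (intro mult_mono) auto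
      also have "\<dots> \<le> A / C * R * (R ^ n / r ^ n)"
      proof -
        have "1 \<le> R ^ n / r ^ n" using r power_mono[of r R n] by simp
        from mult_left_mono[OF this, of "A / C * R"] show ?thesis using A C R0 by simp
      qed
      also have "\<dots> \<le> m" using m_ge by (simp add: mult.assoc)
      also have "\<dots> \<le> P x" using ball x True by blast
      finally show ?thesis .
    next
      case False
      define \<alpha> where "\<alpha> = (x - a) \<bullet> (x - a)"
      define \<beta> where "\<beta> = (x - reflection k a) \<bullet> (x - reflection k a)"
      have \<beta>: "\<beta> = \<alpha> + 4 * x $ k * t" by (simp add: \<alpha>_def \<beta>_def t_def dist_reflection)
      have "x \<noteq> a" using False s by auto
      then have \<alpha>: "\<alpha> > 0" by (simp add: \<alpha>_def)
      have "(norm (z - reflection k a))\<^sup>2 = (norm (z - a))\<^sup>2"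
        unfolding power2_norm_eq_inner dist_reflection by (simp add: zk)
      then have "dist z (reflection k a) = dist z a" by (simp add: dist_norm)
      moreover have "dist z a \<le> R" using r by (simp add: r_def)
      ultimately have "dist x (reflection k a) \<le> 2 * R"
        using x(2) dist_triangle[of x "reflection k a" z] by (simp add: dist_commute)
      then have "(norm (x - reflection k a))\<^sup>2 \<le> (2 * R)\<^sup>2"
        unfolding dist_norm by (intro power_mono) auto
      then have \<beta>R: "\<beta> \<le> 4 * R\<^sup>2" by (simp add: \<beta>_def power2_norm_eq_inner power_mult_distrib)
      have "(\<beta> - \<alpha>) / (4 * R\<^sup>2) ^ (d + 1) \<le> 1 / \<alpha> ^ d - 1 / \<beta> ^ d"
        using \<alpha> \<beta> \<beta>R xk t d by (intro inverse_power_diff_ge) auto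
      then have low: "4 * x $ k * t / (4 * R\<^sup>2) ^ (d + 1) \<le> 1 / \<alpha> ^ d - 1 / \<beta> ^ d" by (simp add: \<beta>)
      \<comment> \<open>The powers of \<open>R\<close> cancel as well: \<open>R ^ (n + 1)\<close>
        from the lower bound for \<open>m\<close> against \<open>(R\<^sup>2) ^ (d + 1)\<close> from
        the comparison function, because \<open>n + 1 = 2 * (d + 1)\<close>.\<close>
      have "c * x $ k = A / C * R ^ (n + 1) / r ^ n * (\<epsilon> * r) ^ n * (B * x $ k / R ^ (n + 1))"
        using R0 r by (simp add: c_def power_mult_distrib)
      also have "\<dots> \<le> m * t ^ n * (B * x $ k / R ^ (n + 1))"
        using m_ge m t_ge \<epsilon> r B xk R0 t by (intro mult_right_mono mult_mono power_mono) auto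
      also have "\<dots> = m * (s\<^sup>2) ^ d * (4 * x $ k * t / (4 * R\<^sup>2) ^ (d + 1))"
      proof -
        have 1: "(s\<^sup>2) ^ d = t ^ (2 * d) / 16 ^ (2 * d)" by (simp only: s_def power_mult[symmetric] power_divide)
        have 2: "(4 * R\<^sup>2) ^ (d + 1) = 4 ^ (d + 1) * R ^ (n + 1)"
        proof -
          have "n + 1 = 2 * (d + 1)" by (simp add: n_def)
          then show ?thesis by (simp only: power_mult_distrib power_mult)
        qed
        have 3: "t ^ n = t ^ (2 * d) * t" by (simp add: n_def)
        show ?thesis unfolding 1 2 3 B_def by (simp add: mult_ac)
      qed
      also have "\<dots> \<le> m * (s\<^sup>2) ^ d * (1 / \<alpha> ^ d - 1 / \<beta> ^ d)"
        using low m by (intro mult_left_mono) auto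
      also have "\<dots> \<le> P x"
        unfolding \<alpha>_def \<beta>_def d_def
        by (rule superharmonic_lower_bound[OF P(1-4) aH s m ball x(1)]) (use False in auto)
      finally show ?thesis .
    qed
  qed
  from inf[OF c] obtain x where x: "x \<in> half_space k" "P x < c * x $ k" by blast
  from lower[OF _ x(1), of "max (2 * e $ k) (dist z x) + 1"] x(2) show False by linarith
qed

section \<open>One-dimensional solutions\<close>

lemma integrable_tail:
  fixes g :: "real \<Rightarrow> real"
  assumes cont: "continuous_on {0<..} g" and int: "set_integrable lborel {1..} g" and s: "s > 0"
  shows "set_integrable lborel {s..} g"
proof -
  have "set_integrable lborel {s..max s 1} g"
    by (rule borel_integrable_atLeastAtMost', rule continuous_on_subset[OF cont]) (use s in auto)
  moreover have "set_integrable lborel {max s 1..} g"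
    by (rule set_integrable_subset[OF int]) auto
  ultimately have "set_integrable lborel ({s..max s 1} \<union> {max s 1..}) g"
    by (rule set_integrable_Un) auto
  moreover have "{s..max s 1} \<union> {max s 1..} = {s..}" by auto
  ultimately show ?thesis by simp
qed

context
  fixes g :: "real \<Rightarrow> real"
  assumes anti: "antimono_on {0<..} g" and pos: "\<forall>t>0. g t > 0"
    and cont: "continuous_on {0<..} g" and int: "set_integrable lborel {1..} g"
begin

lemma integrable_Icc: "0 < s \<Longrightarrow> g integrable_on {s..s'}"
  by (rule integrable_continuous_real, rule continuous_on_subset[OF cont]) auto

lemma integral_nonneg_pos:
  assumes "g integrable_on S" "S \<subseteq> {0<..}"
  shows "integral S g \<ge> 0"
proof (rule integral_nonneg[OF assms(1)])
  show "0 \<le> g x" if "x \<in> S" for x using pos[rule_format, of x] that assms(2) by auto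
qed

text \<open>Connects the interval integral of the definition with the gauge integral, used for
  calculus, and with the set integral, used for the limit at infinity.\<close>

lemma tail_integral_eq:
  assumes "s > 0"
  shows "g integrable_on {s..}" "tail_integral g s = integral {s..} g"
    "tail_integral g s = (LINT t:{s..}|lborel. g t)"
proof -
  note i = integrable_tail[OF cont int assms]
  note i' = set_integrable_subset[OF i, of "{s<..}"]
  show "g integrable_on {s..}" using set_borel_integral_eq_integral(1)[OF i] .
  have "tail_integral g s = (LINT t:{s<..}|lborel. g t)"
    by (simp add: tail_integral_def interval_integral_to_infinity_eq)
  also have "\<dots> = integral {s<..} g" by (rule set_borel_integral_eq_integral(2)[OF i']) auto
  also have "\<dots> = integral {s..} g"
  proof (rule integral_subset_negligible)
    have "{s..} - {s<..} = {s}" by auto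
    then show "negligible ({s..} - {s<..})" by simp
  qed auto
  finally show "tail_integral g s = integral {s..} g" .
  then show "tail_integral g s = (LINT t:{s..}|lborel. g t)"
    using set_borel_integral_eq_integral(2)[OF i] by simp
qed

lemma tail_integral_split:
  assumes "0 < s" "s \<le> s'"
  shows "tail_integral g s = integral {s..s'} g + tail_integral g s'"
proof -
  have "(g has_integral integral {s..s'} g) {s..s'}"
    using integrable_Icc assms by (intro integrable_integral) auto
  moreover have "(g has_integral tail_integral g s') {s'..}"
    using tail_integral_eq[of s'] assms by (simp add: has_integral_integrable_integral)
  moreover have "{s..s'} \<inter> {s'..} = {s'}" using assms by auto
  ultimately have "(g has_integral integral {s..s'} g + tail_integral g s') ({s..s'} \<union> {s'..})"
    by (intro has_integral_Un) auto
  moreover have "{s..s'} \<union> {s'..} = {s..}" using assms by auto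
  ultimately show ?thesis using tail_integral_eq(2)[of s] assms by (simp add: integral_unique)
qed

lemma tail_integral_pos:
  assumes "s > 0"
  shows "tail_integral g s > 0"
proof -
  have "0 < g (s + 1) * 1" using pos[rule_format, of "s + 1"] assms by simp
  also have "\<dots> = integral {s..s + 1} (\<lambda>_. g (s + 1))" by simp
  also have "\<dots> \<le> integral {s..s + 1} g"
  proof (rule integral_le)
    show "g (s + 1) \<le> g t" if "t \<in> {s..s + 1}" for t
      using monotone_onD[OF anti, of t "s + 1"] that assms by simp
  qed (use assms integrable_Icc in auto)
  also have "\<dots> \<le> tail_integral g s"
  proof -
    have "tail_integral g (s + 1) \<ge> 0"
      using tail_integral_eq[of "s + 1"] assms by (auto intro!: integral_nonneg_pos)
    then show ?thesis using tail_integral_split[of s "s + 1"] assms by simp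
  qed
  finally show ?thesis .
qed

lemma tail_integral_antimono:
  assumes "0 < s" "s \<le> s'"
  shows "tail_integral g s' \<le> tail_integral g s"
proof -
  have "0 \<le> integral {s..s'} g"
    by (rule integral_nonneg_pos) (use assms integrable_Icc in auto)
  then show ?thesis using tail_integral_split[OF assms] by simp
qed

lemma tail_integral_derivative:
  assumes "s > 0"
  shows "(tail_integral g has_real_derivative - g s) (at s)"
proof -
  define a b where "a = s / 2" and "b = s + 1"
  have ab: "0 < a" "a < s" "s < b" using assms by (auto simp: a_def b_def)
  have "continuous_on {a..b} g" by (rule continuous_on_subset[OF cont]) (use ab in auto)
  then have "((\<lambda>x. integral {a..x} g) has_real_derivative g s) (at s within {a..b})"
    by (rule integral_has_real_derivative) (use ab in auto)
  then have "((\<lambda>x. integral {a..x} g) has_real_derivative g s) (at s)"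
    using ab by (simp add: at_within_Icc_at)
  then have "((\<lambda>x. tail_integral g a - integral {a..x} g) has_real_derivative 0 - g s) (at s)"
    by (intro DERIV_diff DERIV_const)
  then have "((\<lambda>x. tail_integral g a - integral {a..x} g) has_real_derivative - g s) (at s)" by simp
  then show ?thesis
  proof (rule has_field_derivative_transform_within_open[of _ _ _ "{a<..}"])
    show "tail_integral g a - integral {a..x} g = tail_integral g x" if "x \<in> {a<..}" for x
      using tail_integral_split[of a x] ab that by simp
  qed (use ab in auto)
qed

lemma tail_integral_tendsto_0: "(tail_integral g \<longlongrightarrow> 0) at_top"
proof -
  have 1: "((\<lambda>b. LINT x:{1..b}|lborel. g x) \<longlongrightarrow> (LINT x:{1..}|lborel. g x)) at_top"
    by (rule tendsto_set_lebesgue_integral_at_top[OF _ int]) simp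
  have eq: "(LINT x:{1..b}|lborel. g x) = tail_integral g 1 - tail_integral g b" if "b \<ge> 1" for b
  proof -
    have "set_integrable lborel {1..b} g" by (rule set_integrable_subset[OF int]) auto
    then show ?thesis
      using tail_integral_split[of 1 b] that by (simp add: set_borel_integral_eq_integral(2))
  qed
  have "((\<lambda>b. tail_integral g 1 - (LINT x:{1..b}|lborel. g x)) \<longlongrightarrow> tail_integral g 1 - tail_integral g 1) at_top"
    using tendsto_diff[OF tendsto_const[of "tail_integral g 1"] 1] tail_integral_eq(3)[of 1] by simp
  then show ?thesis
    by (rule Lim_transform_eventually[THEN tendsto_eq_rhs])
      (auto intro!: eventually_mono[OF eventually_ge_at_top[of 1]] simp: eq)
qed

context
  fixes M :: real
  assumes M: "M \<ge> 0"
begin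

text \<open>The value \<open>0\<close> at the origin keeps the integrand monotone on \<open>{0..}\<close>.\<close>

definition inverse_speed :: "real \<Rightarrow> real" where
  "inverse_speed s = (if s > 0 then 1 / sqrt (M + tail_integral g s) else 0)"

text \<open>Multiplying \<open>v'' = - g v\<close> by \<open>v'\<close> and integrating gives
  \<open>v'^2 = 2 (M + F v)\<close>. Separating variables, this is \<open>sqrt 2\<close> times the
  height at which the profile reaches the value \<open>y\<close>.\<close>

definition travel_time :: "real \<Rightarrow> real" where
  "travel_time y = integral {0..y} inverse_speed"

lemma inverse_speed_pos: "s > 0 \<Longrightarrow> inverse_speed s > 0"
  using tail_integral_pos M by (simp add: inverse_speed_def add_nonneg_pos)

lemma inverse_speed_mono: "s \<le> s' \<Longrightarrow> inverse_speed s \<le> inverse_speed s'"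
  using tail_integral_antimono[of s s'] tail_integral_pos[of s'] M
  by (auto simp: inverse_speed_def intro!: divide_left_mono mult_pos_pos add_nonneg_pos)

text \<open>Monotonicity gives integrability down to 0, where \<open>tail_integral g\<close> may be
  unbounded.\<close>

lemma inverse_speed_integrable: "inverse_speed integrable_on {a..b}"
  by (rule integrable_on_mono_on) (auto intro: monotone_onI inverse_speed_mono)

lemma travel_time_continuous: "continuous_on {0..b} travel_time"
  unfolding travel_time_def by (rule indefinite_integral_continuous_1) (rule inverse_speed_integrable)

lemma inverse_speed_continuous:
  assumes "s > 0"
  shows "isCont inverse_speed s"
proof -
  have "isCont (\<lambda>s. 1 / sqrt (M + tail_integral g s)) s"
    using DERIV_isCont[OF tail_integral_derivative[OF assms]] tail_integral_pos[OF assms] M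
    by (intro continuous_intros) (auto simp: add_nonneg_pos less_imp_neq[symmetric])
  moreover have *: "\<forall>\<^sub>F x in nhds s. 1 / sqrt (M + tail_integral g x) = inverse_speed x"
    using eventually_nhds_in_open[of "{0<..}" s] assms by (auto elim!: eventually_mono simp: inverse_speed_def)
  ultimately show ?thesis by (simp add: isCont_cong[OF *])
qed

lemma travel_time_derivative:
  assumes "y > 0"
  shows "(travel_time has_real_derivative inverse_speed y) (at y)"
proof -
  have "continuous (at y within {0..y + 1}) inverse_speed"
    using inverse_speed_continuous[OF assms] by (rule continuous_at_imp_continuous_at_within)
  then have "((\<lambda>u. integral {0..u} inverse_speed) has_vector_derivative inverse_speed y) (at y within {0..y + 1})"
    using integral_has_vector_derivative_continuous_at[OF inverse_speed_integrable[of 0 "y + 1"], of y "{}"] assms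
    by simp
  then have "((\<lambda>u. integral {0..u} inverse_speed) has_vector_derivative inverse_speed y) (at y)"
    using assms by (simp add: at_within_Icc_at)
  then show ?thesis unfolding travel_time_def has_real_derivative_iff_has_vector_derivative .
qed

lemma travel_time_0 [simp]: "travel_time 0 = 0"
  by (simp add: travel_time_def)

lemma travel_time_strict_mono:
  assumes "0 \<le> y" "y < y'"
  shows "travel_time y < travel_time y'"
  using assms
  by (intro DERIV_pos_imp_increasing_open[OF assms(2)])
    (auto intro!: exI travel_time_derivative inverse_speed_pos continuous_on_subset[OF travel_time_continuous[of y']])

lemma travel_time_eq_iff: "0 \<le> y \<Longrightarrow> 0 \<le> y' \<Longrightarrow> travel_time y = travel_time y' \<longleftrightarrow> y = y'"
  using travel_time_strict_mono[of y y'] travel_time_strict_mono[of y' y] by (cases y y' rule: linorder_cases) auto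

lemma travel_time_surj:
  assumes "\<tau> \<ge> 0"
  shows "\<exists>y\<ge>0. travel_time y = \<tau>"
proof -
  \<comment> \<open>Beyond 1 the integrand is at least \<open>inverse_speed 1\<close>, so the
    interval \<open>{1..b}\<close> alone contributes \<open>\<tau>\<close>.\<close>
  define b where "b = 1 + \<tau> / inverse_speed 1"
  have h: "inverse_speed 1 > 0" by (rule inverse_speed_pos) simp
  then have b: "b \<ge> 1" using assms by (simp add: b_def)
  have "\<tau> = integral {1..b} (\<lambda>_. inverse_speed 1)" using h b by (simp add: b_def)
  also have "\<dots> \<le> integral {1..b} inverse_speed"
    by (rule integral_le) (auto intro: inverse_speed_integrable inverse_speed_mono)
  also have "\<dots> \<le> integral {0..b} inverse_speed"
    by (rule integral_subset_le)
      (use inverse_speed_mono[of 0] in \<open>auto intro: inverse_speed_integrable simp: inverse_speed_def[of 0]\<close>)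
  finally have "\<tau> \<le> travel_time b" by (simp add: travel_time_def)
  then show ?thesis using IVT'[of travel_time 0 \<tau> b] travel_time_continuous[of b] assms b by auto
qed

text \<open>The fundamental theorem for nonnegative integrands, with one-sided limits at both ends,
  identifies the Lebesgue integral of the formula with the gauge integral.\<close>

lemma travel_time_eq_LBINT:
  assumes "y \<ge> 0"
  shows "(LBINT s=ereal 0..ereal y. 1 / sqrt (M + tail_integral g s)) = travel_time y"
proof (cases "y = 0")
  case False
  with assms have y: "y > 0" by simp
  have h: "1 / sqrt (M + tail_integral g s) = inverse_speed s" if "s > 0" for s
    using that by (simp add: inverse_speed_def)
  have "(LBINT s=ereal 0..ereal y. 1 / sqrt (M + tail_integral g s))
      = (LBINT s=ereal 0..ereal y. inverse_speed s)"
    by (rule interval_integral_cong) (use y h in \<open>auto simp: einterval_def\<close>)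
  also have "\<dots> = travel_time y - travel_time 0"
  proof (rule interval_integral_FTC_nonneg(2))
    show "AE x in lborel. ereal 0 < ereal x \<longrightarrow> ereal x < ereal y \<longrightarrow> 0 \<le> inverse_speed x"
      using inverse_speed_pos by (auto intro: less_imp_le)
    have "(travel_time \<longlongrightarrow> travel_time 0) (at 0 within {0..y})" "(travel_time \<longlongrightarrow> travel_time y) (at y within {0..y})"
      using travel_time_continuous[of y] y by (auto simp: continuous_on_def simp del: travel_time_0)
    then show "((travel_time \<circ> real_of_ereal) \<longlongrightarrow> travel_time 0) (at_right (ereal 0))"
      "((travel_time \<circ> real_of_ereal) \<longlongrightarrow> travel_time y) (at_left (ereal y))"
      using y by (auto simp only: ereal_tendsto_simps at_within_Icc_at_right at_within_Icc_at_left)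
  qed (use y in \<open>auto intro: travel_time_derivative inverse_speed_continuous\<close>)
  finally show ?thesis by simp
qed simp

definition profile :: "real \<Rightarrow> real" where
  "profile t = (THE y. y \<ge> 0 \<and> travel_time y = sqrt 2 * t)"

lemma profile_iff:
  assumes "t \<ge> 0"
  shows "profile t = y \<longleftrightarrow> y \<ge> 0 \<and> travel_time y = sqrt 2 * t" 
proof -
  have "\<exists>!y. y \<ge> 0 \<and> travel_time y = sqrt 2 * t"
    using travel_time_surj[of "sqrt 2 * t"] assms travel_time_eq_iff by fastforce
  from theI'[OF this] the1_equality[OF this] show ?thesis unfolding profile_def by blast
qed

lemma profile_nonneg: "t \<ge> 0 \<Longrightarrow> profile t \<ge> 0"
  and travel_time_profile: "t \<ge> 0 \<Longrightarrow> travel_time (profile t) = sqrt 2 * t"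
  using profile_iff[of t "profile t"] by auto

lemma determined_by_formula_profile: "determined_by_formula g M profile"
  unfolding determined_by_formula_def
proof (intro allI impI conjI)
  fix t :: real assume t: "t \<ge> 0"
  show "profile t \<ge> 0" by (rule profile_nonneg[OF t])
  fix y :: real assume y: "y \<ge> 0"
  show "((LBINT s=ereal 0..ereal y. 1 / sqrt (M + tail_integral g s)) = sqrt 2 * t) = (y = profile t)"
    unfolding travel_time_eq_LBINT[OF y] using profile_iff[OF t, of y] y by auto
qed

lemma profile_0 [simp]: "profile 0 = 0"
  using profile_iff[of 0 0] by simp

lemma less_profile_iff:
  assumes "t \<ge> 0" "y \<ge> 0"
  shows "y < profile t \<longleftrightarrow> travel_time y < sqrt 2 * t"
  using travel_time_strict_mono[of y "profile t"] travel_time_strict_mono[of "profile t" y]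
    travel_time_profile[OF assms(1)] profile_nonneg[OF assms(1)] assms(2)
  by (cases y "profile t" rule: linorder_cases) auto

lemma profile_pos: "t > 0 \<Longrightarrow> profile t > 0"
  using less_profile_iff[of t 0] by simp

lemma profile_travel_time: "y \<ge> 0 \<Longrightarrow> profile (travel_time y / sqrt 2) = y"
  using profile_iff[of "travel_time y / sqrt 2" y] travel_time_strict_mono[of 0 y]
  by (cases "y = 0") auto

lemma profile_isCont:
  assumes "t > 0"
  shows "isCont profile t"
proof -
  define y where "y = profile t"
  have y: "y > 0" unfolding y_def by (rule profile_pos[OF assms])
  have "isCont profile (travel_time y / sqrt 2)"
  proof (rule isCont_inverse_function[where f = "\<lambda>z. travel_time z / sqrt 2" and x = y and d = "y / 2"])
    fix z assume "\<bar>z - y\<bar> \<le> y / 2"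
    then have z: "z > 0" using y by linarith
    show "profile (travel_time z / sqrt 2) = z" using z by (simp add: profile_travel_time)
    show "isCont (\<lambda>z. travel_time z / sqrt 2) z"
      using DERIV_isCont[OF travel_time_derivative[OF z]] by (intro continuous_intros) auto
  qed (use y in simp)
  then show ?thesis using travel_time_profile[of t] assms by (simp add: y_def)
qed

lemma profile_derivative:
  assumes "t > 0"
  shows "(profile has_real_derivative sqrt 2 * sqrt (M + tail_integral g (profile t))) (at t)"
proof -
  note p = profile_pos[OF assms]
  have "((\<lambda>y. travel_time y / sqrt 2) has_real_derivative inverse_speed (profile t) / sqrt 2) (at (profile t))"
    by (rule DERIV_cdivide[OF travel_time_derivative[OF p]])
  then have "(profile has_real_derivative inverse (inverse_speed (profile t) / sqrt 2)) (at t)"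
    by (rule DERIV_inverse_function[where a = 0 and b = "t + 1"])
      (use assms inverse_speed_pos[OF p] travel_time_profile profile_isCont in auto)
  then show ?thesis using p by (simp add: inverse_speed_def field_simps)
qed

lemma profile_second_derivative:
  assumes "t > 0"
  shows "((\<lambda>t. sqrt 2 * sqrt (M + tail_integral g (profile t))) has_real_derivative - g (profile t)) (at t)"
proof -
  let ?q = "M + tail_integral g (profile t)"
  note p = profile_pos[OF assms]
  have q: "?q > 0" using tail_integral_pos[OF p] M by simp
  have "((\<lambda>t. tail_integral g (profile t)) has_real_derivative - g (profile t) * (sqrt 2 * sqrt ?q)) (at t)"
    by (rule DERIV_chain2[OF tail_integral_derivative[OF p] profile_derivative[OF assms]])
  then have "((\<lambda>t. M + tail_integral g (profile t)) has_real_derivative 0 + - g (profile t) * (sqrt 2 * sqrt ?q)) (at t)"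
    by (intro DERIV_add DERIV_const)
  from DERIV_cmult[OF DERIV_chain2[OF DERIV_real_sqrt[OF q] this], of "sqrt 2"]
  show ?thesis by (rule DERIV_cong) (use q in \<open>simp add: field_simps\<close>)
qed

lemma profile_continuous_on: "continuous_on {0..} profile"
  unfolding continuous_on_eq_continuous_within
proof
  fix t :: real assume "t \<in> {0..}"
  then consider "t > 0" | "t = 0" by force
  then show "continuous (at t within {0..}) profile"
  proof cases
    case 1
    then show ?thesis using profile_isCont continuous_at_imp_continuous_at_within by blast
  next
    case 2
    \<comment> \<open>The slope at 0 is infinite when \<open>tail_integral g\<close> is unbounded
      there. Continuity comes from inverting \<open>travel_time\<close>: before the height at which
      the profile reaches \<open>e / 2\<close> it cannot exceed that value.\<close>
    have "\<exists>d>0. \<forall>x\<in>{0..}. dist x 0 < d \<longrightarrow> dist (profile x) 0 < e" if "e > 0" for e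
    proof (intro exI conjI ballI impI)
      have "travel_time e > 0" using travel_time_strict_mono[of 0 e] that by simp
      then have "travel_time (e / 2) < travel_time e" "travel_time (e / 2) > 0"
        using travel_time_strict_mono[of "e / 2" e] travel_time_strict_mono[of 0 "e / 2"] that by auto
      then show "travel_time (e / 2) / sqrt 2 > 0" by simp
      fix x :: real assume x: "x \<in> {0..}" "dist x 0 < travel_time (e / 2) / sqrt 2"
      then have "sqrt 2 * x < travel_time (e / 2)" by (simp add: field_simps)
      then have "\<not> e / 2 < profile x" using less_profile_iff[of x "e / 2"] x that by auto
      then show "dist (profile x) 0 < e" using that profile_nonneg[of x] x by (simp add: dist_norm)
    qed
    then show ?thesis using 2 by (simp add: continuous_within_eps_delta)
  qed
qed

lemma profile_mvt:
  assumes "0 \<le> s" "s < t"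
  shows "\<exists>\<xi>>s. \<xi> < t \<and> profile t - profile s = (t - s) * (sqrt 2 * sqrt (M + tail_integral g (profile \<xi>)))"
proof -
  have "\<exists>l z. s < z \<and> z < t \<and> (profile has_real_derivative l) (at z) \<and> profile t - profile s = (t - s) * l"
  proof (rule MVT[OF assms(2)])
    show "profile differentiable (at x)" if "s < x" for x
      using profile_derivative[of x] that assms unfolding real_differentiable_def by auto
  qed (use assms in \<open>auto intro!: continuous_on_subset[OF profile_continuous_on]\<close>)
  then obtain l z where z: "s < z" "z < t" "(profile has_real_derivative l) (at z)"
    "profile t - profile s = (t - s) * l" by blast
  have "l = sqrt 2 * sqrt (M + tail_integral g (profile z))"
    by (rule DERIV_unique[OF z(3) profile_derivative]) (use z assms in simp)
  with z show ?thesis by blast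
qed

lemma profile_mono:
  assumes "0 \<le> s" "s \<le> t"
  shows "profile s \<le> profile t"
proof (cases "s = t")
  case False
  with assms obtain \<xi> where "s < \<xi>" "profile t - profile s = (t - s) * (sqrt 2 * sqrt (M + tail_integral g (profile \<xi>)))"
    using profile_mvt[of s t] by auto
  moreover have "M + tail_integral g (profile \<xi>) \<ge> 0"
    using tail_integral_pos[OF profile_pos[of \<xi>]] M \<open>s < \<xi>\<close> assms by simp
  ultimately have "profile t - profile s \<ge> 0" using assms by simp
  then show ?thesis by simp
qed simp

lemma profile_ge_linear:
  assumes "t \<ge> 0"
  shows "sqrt (2 * M) * t \<le> profile t"
proof (cases "t = 0")
  case False
  then obtain \<xi> where \<xi>: "0 < \<xi>" "profile t = t * (sqrt 2 * sqrt (M + tail_integral g (profile \<xi>)))"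
    using profile_mvt[of 0 t] assms by auto
  have "sqrt M \<le> sqrt (M + tail_integral g (profile \<xi>))"
    using tail_integral_pos[OF profile_pos[OF \<xi>(1)]] by simp
  then have "t * (sqrt 2 * sqrt M) \<le> profile t" unfolding \<xi>(2) using assms by (intro mult_left_mono) auto
  then show ?thesis by (simp add: real_sqrt_mult mult.commute)
qed simp

text \<open>The profile is concave, so its slope at \<open>t\<close> is at most its mean slope from
  0 to \<open>t\<close>. A bound on the profile at one height thus becomes a bound on a tail
  integral.\<close>

lemma profile_ge_slope:
  assumes "t > 0"
  shows "t * (sqrt 2 * sqrt (M + tail_integral g (profile t))) \<le> profile t"
proof -
  obtain \<xi> where \<xi>: "0 < \<xi>" "\<xi> < t" "profile t = t * (sqrt 2 * sqrt (M + tail_integral g (profile \<xi>)))"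
    using profile_mvt[of 0 t] assms by auto
  have "tail_integral g (profile t) \<le> tail_integral g (profile \<xi>)"
    by (rule tail_integral_antimono) (use \<xi> profile_pos profile_mono[of \<xi> t] in auto)
  then show ?thesis using assms by (subst \<xi>(3)) (intro mult_left_mono, auto)
qed

text \<open>As \<open>tail_integral g\<close> tends to 0, the slope tends to
  \<open>sqrt (2 * M)\<close>. An error of the form \<open>\<epsilon> * t + C\<close> is what the
  growth condition of Phragmen-Lindelof tolerates.\<close>

lemma profile_le_linear:
  assumes \<epsilon>: "\<epsilon> > 0"
  shows "\<exists>C. \<forall>t>0. profile t \<le> (sqrt (2 * M) + \<epsilon>) * t + C"
proof -
  have "\<forall>\<^sub>F y in at_top. tail_integral g y < \<epsilon>\<^sup>2 / 2"
    using tail_integral_tendsto_0 \<epsilon> by (intro order_tendstoD) auto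
  then obtain Y where Y: "\<And>y. y \<ge> Y \<Longrightarrow> tail_integral g y < \<epsilon>\<^sup>2 / 2"
    by (auto simp: eventually_at_top_linorder)
  define T where "T = travel_time (max Y 1) / sqrt 2"
  have T: "profile T = max Y 1" unfolding T_def by (rule profile_travel_time) simp
  have "travel_time (max Y 1) > 0" using travel_time_strict_mono[of 0 "max Y 1"] by simp
  then have T0: "T > 0" by (simp add: T_def)
  have "profile t \<le> (sqrt (2 * M) + \<epsilon>) * t + profile T" if t: "t > 0" for t
  proof (cases "t \<le> T")
    case True
    then have "profile t \<le> profile T" using t by (intro profile_mono) auto
    moreover have "(sqrt (2 * M) + \<epsilon>) * t \<ge> 0" using t \<epsilon> M by simp
    ultimately show ?thesis by linarith
  next
    case False
    then obtain \<xi> where \<xi>: "T < \<xi>" "\<xi> < t"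
      "profile t - profile T = (t - T) * (sqrt 2 * sqrt (M + tail_integral g (profile \<xi>)))"
      using profile_mvt[of T t] T0 by auto
    have "profile \<xi> \<ge> Y" using profile_mono[of T \<xi>] T0 \<xi> T by simp
    then have "M + tail_integral g (profile \<xi>) \<le> M + \<epsilon>\<^sup>2 / 2" using Y[of "profile \<xi>"] by simp
    then have "sqrt (2 * (M + tail_integral g (profile \<xi>))) \<le> sqrt (2 * M + \<epsilon>\<^sup>2)" by simp
    also have "\<dots> \<le> sqrt (2 * M) + sqrt (\<epsilon>\<^sup>2)" using M by (intro sqrt_add_le_add_sqrt) auto
    finally have "sqrt 2 * sqrt (M + tail_integral g (profile \<xi>)) \<le> sqrt (2 * M) + \<epsilon>"
      using \<epsilon> by (simp only: real_sqrt_mult[symmetric] real_sqrt_abs abs_of_pos)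
    then have "profile t - profile T \<le> (t - T) * (sqrt (2 * M) + \<epsilon>)"
      unfolding \<xi>(3) using False by (intro mult_left_mono) auto
    also have "\<dots> \<le> t * (sqrt (2 * M) + \<epsilon>)" using T0 \<epsilon> M by (intro mult_right_mono) auto
    finally show ?thesis by (simp add: mult.commute)
  qed
  then show ?thesis by blast
qed

end

end

section \<open>Solutions in the half space\<close>

lemma integrable_on_Ici_if_bounded:
  fixes h :: "real \<Rightarrow> real"
  assumes int: "\<And>b. h integrable_on {a..b}" and nonneg: "\<And>x. x \<ge> a \<Longrightarrow> h x \<ge> 0"
    and bound: "\<And>b. b \<ge> a \<Longrightarrow> integral {a..b} h \<le> K"
  shows "h integrable_on {a..}"
proof -
  define F where "F = (\<lambda>n x. if x \<in> {a..a + real n} then h x else 0)"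
  have F: "(F n has_integral integral {a..a + real n} h) {a..}" for n
    unfolding F_def by (subst has_integral_restrict) (auto intro: integrable_integral int)
  have "h integrable_on {a..} \<and> (\<lambda>n. integral {a..} (F n)) \<longlonglongrightarrow> integral {a..} h"
  proof (rule monotone_convergence_increasing)
    show "F n integrable_on {a..}" for n using F by blast
    show "F n x \<le> F (Suc n) x" if "x \<in> {a..}" for n x using nonneg that by (auto simp: F_def)
    show "(\<lambda>n. F n x) \<longlonglongrightarrow> h x" if "x \<in> {a..}" for x
    proof (rule tendsto_eventually)
      have "\<forall>\<^sub>F n in sequentially. x - a \<le> real n"
        using eventually_ge_at_top[of "nat \<lceil>x - a\<rceil>"] by eventually_elim linarith
      then show "\<forall>\<^sub>F n in sequentially. F n x = h x"
        by eventually_elim (use that in \<open>auto simp: F_def\<close>)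
    qed
    have "norm (integral {a..} (F n)) \<le> K" for n
    proof -
      have "0 \<le> integral {a..a + real n} h" by (rule integral_nonneg[OF int]) (use nonneg in auto)
      then show ?thesis using bound[of "a + real n"] integral_unique[OF F, of n] by simp
    qed
    then show "bounded (range (\<lambda>n. integral {a..} (F n)))" by (auto intro!: boundedI)
  qed
  then show ?thesis ..
qed

lemma integrable_on_Ici_iff:
  fixes g :: "real \<Rightarrow> real"
  assumes cont: "continuous_on {a..} g" and nonneg: "\<And>t. t \<ge> a \<Longrightarrow> g t \<ge> 0"
  shows "g integrable_on {a..} \<longleftrightarrow> set_integrable lborel {a..} g"
    and "(\<integral>\<^sup>+t\<in>{a..}. ennreal (g t) \<partial>lborel) < \<infinity> \<longleftrightarrow> set_integrable lborel {a..} g"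
proof -
  have m: "(\<lambda>x. indicat_real {a..} x *\<^sub>R g x) \<in> borel_measurable lborel"
    using borel_measurable_continuous_on_indicator[OF _ cont] by simp
  have eq: "(\<integral>\<^sup>+t\<in>{a..}. ennreal (g t) \<partial>lborel) = (\<integral>\<^sup>+t. ennreal (indicat_real {a..} t *\<^sub>R g t) \<partial>lborel)"
    by (intro nn_integral_cong) (auto simp: indicator_def)
  have 1: "set_integrable lborel {a..} g" if "(\<integral>\<^sup>+t\<in>{a..}. ennreal (g t) \<partial>lborel) < \<infinity>"
    unfolding set_integrable_def
  proof (rule integrableI_nonneg[OF m])
    show "(\<integral>\<^sup>+t. ennreal (indicat_real {a..} t *\<^sub>R g t) \<partial>lborel) < \<infinity>"
      using that unfolding eq .
  qed (use nonneg in \<open>auto simp: indicator_def\<close>)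
  have 2: "(\<integral>\<^sup>+t\<in>{a..}. ennreal (g t) \<partial>lborel) < \<infinity>" if "g integrable_on {a..}"
    using nn_integral_has_integral_lebesgue'[OF _ integrable_integral[OF that]] nonneg by simp
  have 3: "g integrable_on {a..}" if "set_integrable lborel {a..} g"
    using set_borel_integral_eq_integral(1)[OF that] .
  show "g integrable_on {a..} \<longleftrightarrow> set_integrable lborel {a..} g" using 1 2 3 by blast
  show "(\<integral>\<^sup>+t\<in>{a..}. ennreal (g t) \<partial>lborel) < \<infinity> \<longleftrightarrow> set_integrable lborel {a..} g"
    using 1 2 3 by blast
qed

lemma C2_on_profile:
  fixes k :: "'n::finite" and g :: "real \<Rightarrow> real"
  assumes g: "antimono_on {0<..} g" "\<forall>t>0. g t > 0" "continuous_on {0<..} g"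
    "set_integrable lborel {1..} g" and M: "M \<ge> 0"
  defines "v \<equiv> profile g M"
  shows "C2_on (half_space k) (\<lambda>x. v (x $ k))"
    and "\<And>x. x \<in> half_space k \<Longrightarrow> laplacian (\<lambda>x. v (x $ k)) x = - g (v (x $ k))"
    and "continuous_on (closure (half_space k)) (\<lambda>x. v (x $ k))"
    and "\<And>x. x \<in> half_space k \<Longrightarrow> v (x $ k) > 0"
    and "\<And>x. x \<in> closure (half_space k) \<Longrightarrow> v (x $ k) \<ge> 0"
    and "\<And>x. x \<in> frontier (half_space k) \<Longrightarrow> v (x $ k) = 0"
proof -
  have xk: "x $ k > 0" if "x \<in> half_space k" for x using that by (simp add: half_space_def)
  show vc: "continuous_on (closure (half_space k)) (\<lambda>x. v (x $ k))"
    unfolding v_def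
    by (rule continuous_on_compose2[OF profile_continuous_on[OF g M]])
      (auto intro!: continuous_intros simp: closure_half_space)
  have cv: "continuous_on (half_space k) (\<lambda>x. v (x $ k))"
    by (rule continuous_on_subset[OF vc closure_subset])
  have c: "continuous_on (half_space k) (\<lambda>x. - g (v (x $ k)))"
    by (intro continuous_intros continuous_on_compose2[OF g(3) cv])
      (use xk profile_pos[OF g M] in \<open>auto simp: v_def\<close>)
  note D = profile_derivative[OF g M] profile_second_derivative[OF g M]
  show "C2_on (half_space k) (\<lambda>x. v (x $ k))"
    by (rule C2_on_coordinate(1)[OF open_half_space, where
          h' = "\<lambda>t. sqrt 2 * sqrt (M + tail_integral g (v t))" and h'' = "\<lambda>t. - g (v t)"])
      (use D xk c in \<open>auto simp: v_def\<close>)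
  show "laplacian (\<lambda>x. v (x $ k)) x = - g (v (x $ k))" if "x \<in> half_space k" for x
    by (rule C2_on_coordinate(2)[OF open_half_space, where
          h' = "\<lambda>t. sqrt 2 * sqrt (M + tail_integral g (v t))" and h'' = "\<lambda>t. - g (v t)"])
      (use D xk c that in \<open>auto simp: v_def\<close>)
  show "\<And>x. x \<in> half_space k \<Longrightarrow> v (x $ k) > 0"
    using profile_pos[OF g M] xk by (simp add: v_def)
  show "\<And>x. x \<in> closure (half_space k) \<Longrightarrow> v (x $ k) \<ge> 0"
    using profile_nonneg[OF g M] by (simp add: v_def closure_half_space)
  show "\<And>x. x \<in> frontier (half_space k) \<Longrightarrow> v (x $ k) = 0"
    by (simp add: v_def frontier_half_space profile_0[OF g M])
qed

text \<open>Stated for a minorant \<open>g\<close> because it serves twice: for truncations of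
  \<open>f\<close>, before \<open>f\<close> is known to be integrable, and then for \<open>f\<close>
  itself. Where the profile exceeds \<open>u\<close>, \<open>g\<close> at the profile is at most
  \<open>f\<close> there, hence at most \<open>f\<close> at \<open>u\<close>.\<close>

lemma profile_le_solution:
  fixes f g :: "real \<Rightarrow> real" and k :: "'n::finite" and u :: "real ^ 'n \<Rightarrow> real"
  assumes f: "antimono_on {0<..} f" and u: "is_solution f k u"
    and g: "antimono_on {0<..} g" "\<forall>t>0. g t > 0" "continuous_on {0<..} g"
    "set_integrable lborel {1..} g" and M: "M \<ge> 0"
    and gf: "\<And>t. t > 0 \<Longrightarrow> g t \<le> f t"
    and lin: "\<And>x. x \<in> half_space k \<Longrightarrow> sqrt (2 * M) * x $ k \<le> u x"
    and x: "x \<in> closure (half_space k)"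
  shows "profile g M (x $ k) \<le> u x"
proof -
  define v where "v = profile g M"
  note v = C2_on_profile[OF g M, where k = k, folded v_def]
  have uC2: "C2_on (half_space k) u" and uc: "continuous_on (closure (half_space k)) u"
    and upos: "\<And>x. x \<in> half_space k \<Longrightarrow> u x > 0"
    and ulap: "\<And>x. x \<in> half_space k \<Longrightarrow> laplacian u x = - f (u x)"
    and u0: "\<And>x. x \<in> frontier (half_space k) \<Longrightarrow> u x = 0"
    using u unfolding is_solution_def by force+
  define w where "w = (\<lambda>x. 1 * v (x $ k) + (- 1) * u x)"
  note w2 = C2_on_lincomb[OF open_half_space v(1) uC2, where a = 1 and b = "- 1", folded w_def]
  have "w x \<le> 0"
  proof (rule phragmen_lindelof_half_space[OF w2(1) _ _ _ _ x])
    show "continuous_on (closure (half_space k)) w"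
      unfolding w_def using v(3) uc by (intro continuous_intros)
    show "0 \<le> laplacian w y" if "y \<in> half_space k" "0 < w y" for y
    proof -
      have "g (v (y $ k)) \<le> f (v (y $ k))" using gf v(4) that by blast
      also have "\<dots> \<le> f (u y)"
        using that upos[OF that(1)] v(4)[OF that(1)] by (intro monotone_onD[OF f]) (auto simp: w_def)
      finally show ?thesis using w2(2) v(2) ulap that(1) by simp
    qed
    show "w y \<le> 0" if "y \<in> frontier (half_space k)" for y
      using v(6)[OF that] u0[OF that] by (simp add: w_def)
    show "\<exists>C. \<forall>y\<in>half_space k. w y \<le> \<epsilon> * y $ k + C" if \<epsilon>: "\<epsilon> > 0" for \<epsilon>
    proof -
      obtain C where C: "\<And>t. t > 0 \<Longrightarrow> v t \<le> (sqrt (2 * M) + \<epsilon>) * t + C"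
        using profile_le_linear[OF g M \<epsilon>] unfolding v_def by blast
      have "w y \<le> \<epsilon> * y $ k + C" if y: "y \<in> half_space k" for y
        using C[of "y $ k"] lin[OF y] y unfolding w_def half_space_def by (simp add: distrib_right)
      then show ?thesis by blast
    qed
  qed
  then show ?thesis by (simp add: w_def v_def)
qed

text \<open>
  The truncations \<open>g t = f t * min 1 (B\<^sup>2 / t\<^sup>2)\<close> are integrable, lie below \<open>f\<close> and agree with it up to
  \<open>B\<close>; their profiles stay below \<open>u\<close>, which bounds the integral of \<open>f\<close> up to \<open>B\<close> independently of \<open>B\<close>.
\<close>

lemma solution_imp_integrable:
  fixes f :: "real \<Rightarrow> real" and k :: "'n::finite" and u :: "real ^ 'n \<Rightarrow> real"
  assumes f: "antimono_on {0<..} f" "\<forall>t>0. f t > 0" "continuous_on {0<..} f"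
    and u: "is_solution f k u"
  shows "set_integrable lborel {1..} f"
proof -
  define e where "e = (axis k 1 :: real ^ 'n)"
  have e: "e \<in> half_space k" "e \<in> closure (half_space k)" "e $ k = 1"
    by (simp_all add: e_def half_space_def closure_half_space)
  \<comment> \<open>\<open>u e\<close> is a value of \<open>u\<close> at height 1 and bounds all the
    truncated profiles there, whatever \<open>B\<close> is; the maximum with 1 leaves only the
    compact interval \<open>{1..y}\<close> to be added at the end.\<close>
  define y where "y = max 1 (u e)"
  have y: "y \<ge> 1" by (simp add: y_def)
  have bound: "integral {y..B} f \<le> y\<^sup>2 / 2" if B: "B \<ge> y" for B
  proof -
    define g where "g = (\<lambda>t. f t * min 1 (B\<^sup>2 / t\<^sup>2))"
    have B0: "B > 0" using B y by simp
    have m: "0 < min 1 (B\<^sup>2 / t\<^sup>2)" "min 1 (B\<^sup>2 / t\<^sup>2) \<le> 1" if "t > 0" for t using that B0 by auto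
    have gf: "g t \<le> f t" if "t > 0" for t
      using m[OF that] f(2)[rule_format, OF that] by (simp add: g_def mult_left_le less_imp_le)
    have g: "antimono_on {0<..} g" "\<forall>t>0. g t > 0" "continuous_on {0<..} g"
    proof -
      show "antimono_on {0<..} g"
      proof (rule monotone_onI)
        fix s t :: real assume st: "s \<in> {0<..}" "t \<in> {0<..}" "s \<le> t"
        have "B\<^sup>2 / t\<^sup>2 \<le> B\<^sup>2 / s\<^sup>2" using st by (intro divide_left_mono power_mono mult_pos_pos) auto
        then have "min 1 (B\<^sup>2 / t\<^sup>2) \<le> min 1 (B\<^sup>2 / s\<^sup>2)" by (intro min.mono) auto
        moreover have "f t \<le> f s" using monotone_onD[OF f(1) st] by simp
        ultimately show "g t \<le> g s"
          unfolding g_def using st m[of t] f(2)[rule_format, of s] by (intro mult_mono) auto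
      qed
      show "\<forall>t>0. g t > 0" unfolding g_def using m f(2) by (simp add: mult_pos_pos)
      show "continuous_on {0<..} g" unfolding g_def by (intro continuous_intros f(3)) auto
    qed
    have g4: "set_integrable lborel {1..} g"
    proof (subst integrable_on_Ici_iff(1)[symmetric])
      have p: "((\<lambda>t. f 1 * B\<^sup>2 * (1 / t ^ 2)) has_integral f 1 * B\<^sup>2 * (1 / (real (2 - 1) * 1 ^ (2 - 1)))) {1..}"
        by (intro has_integral_mult_right has_integral_inverse_power_to_inf) auto
      have i: "g integrable_on {1..b}" for b
        by (rule integrable_continuous_real, rule continuous_on_subset[OF g(3)]) auto
      show "g integrable_on {1..}"
      proof (rule integrable_on_Ici_if_bounded[OF i])
        show "integral {1..b} g \<le> f 1 * B\<^sup>2" for b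
        proof -
          have pi: "(\<lambda>t. f 1 * B\<^sup>2 * (1 / t ^ 2)) integrable_on {1..b}"
            by (intro integrable_continuous_real continuous_intros) auto
          have "integral {1..b} g \<le> integral {1..b} (\<lambda>t. f 1 * B\<^sup>2 * (1 / t ^ 2))"
          proof (rule integral_le[OF i pi])
            fix t assume t: "t \<in> {1..b}"
            then have "f t \<le> f 1" using monotone_onD[OF f(1), of 1 t] by simp
            then have "g t \<le> f 1 * (B\<^sup>2 / t\<^sup>2)"
              unfolding g_def using t f(2)[rule_format, of 1] m[of t] by (intro mult_mono) auto
            then show "g t \<le> f 1 * B\<^sup>2 * (1 / t\<^sup>2)" by simp
          qed
          also have "\<dots> \<le> integral {1..} (\<lambda>t. f 1 * B\<^sup>2 * (1 / t ^ 2))"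
            by (rule integral_subset_le[OF _ pi has_integral_integrable[OF p]]) (use f(2)[rule_format, of 1] in auto)
          also have "\<dots> = f 1 * B\<^sup>2" using integral_unique[OF p] by simp
          finally show ?thesis .
        qed
        show "0 \<le> g x" if "1 \<le> x" for x using g(2)[rule_format, of x] that by simp
      qed
      show "continuous_on {1..} g" by (rule continuous_on_subset[OF g(3)]) auto
      show "0 \<le> g x" if "1 \<le> x" for x using g(2)[rule_format, of x] that by simp
    qed
    \<comment> \<open>With \<open>M = 0\<close> the linear lower bound demanded of \<open>u\<close>
      reduces to \<open>u \<ge> 0\<close>.\<close>
    define v where "v = profile g 0"
    have "v (e $ k) \<le> u e"
      unfolding v_def
      by (rule profile_le_solution[OF f(1) u g g4 _ gf _ e(2)]) (use u in \<open>auto simp: is_solution_def order_less_le\<close>)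
    then have vy: "v 1 \<le> y" by (simp add: e y_def)
    have v0: "v 1 > 0" unfolding v_def by (rule profile_pos[OF g g4]) auto
    have "integral {y..B} f = integral {y..B} g" 
      by (rule integral_cong) (use y B0 in \<open>auto simp: g_def field_simps intro!: power_mono\<close>)
    also have "\<dots> \<le> tail_integral g y"
      using tail_integral_split[OF g g4, of y B] tail_integral_pos[OF g g4 B0] y B by simp
    also have "\<dots> \<le> tail_integral g (v 1)" by (rule tail_integral_antimono[OF g g4 v0 vy])
    also have "\<dots> \<le> y\<^sup>2 / 2"
    \<comment> \<open>The mean slope inequality at height 1 reads
      \<open>sqrt (2 * tail_integral g (v 1)) \<le> v 1\<close>, and
      \<open>v 1 \<le> y\<close>.\<close>
    proof -
      have "sqrt 2 * sqrt (tail_integral g (v 1)) \<le> v 1"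
        using profile_ge_slope[OF g g4, of 0 1] by (simp add: v_def)
      then have "sqrt (2 * tail_integral g (v 1)) \<le> y" using vy by (simp add: real_sqrt_mult)
      then have "2 * tail_integral g (v 1) \<le> y\<^sup>2" by (rule sqrt_le_D)
      then show ?thesis by simp
    qed
    finally show ?thesis .
  qed
  have "f integrable_on {y..}"
  proof (rule integrable_on_Ici_if_bounded[OF _ _ bound])
    show "f integrable_on {y..b}" for b
      by (rule integrable_continuous_real, rule continuous_on_subset[OF f(3)]) (use y in auto)
    show "0 \<le> f x" if "y \<le> x" for x using f(2)[rule_format, of x] that y by simp
  qed
  moreover have "continuous_on {y..} f" by (rule continuous_on_subset[OF f(3)]) (use y in auto)
  moreover have "0 \<le> f x" if "y \<le> x" for x using f(2)[rule_format, of x] that y by simp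
  ultimately have "set_integrable lborel {y..} f" by (simp add: integrable_on_Ici_iff(1)[symmetric])
  moreover have "set_integrable lborel {1..y} f"
    by (rule borel_integrable_atLeastAtMost', rule continuous_on_subset[OF f(3)]) auto
  ultimately have "set_integrable lborel ({1..y} \<union> {y..}) f" by (intro set_integrable_Un) auto
  moreover have "{1..y} \<union> {y..} = {1..}" using y by auto
  ultimately show ?thesis by simp
qed

lemma solution_eq_profile:
  fixes f :: "real \<Rightarrow> real" and k :: "'n::finite" and u :: "real ^ 'n \<Rightarrow> real"
  assumes f: "antimono_on {0<..} f" "\<forall>t>0. f t > 0" "continuous_on {0<..} f"
    and u: "is_solution f k u"
  shows "\<exists>M\<ge>0. \<forall>x\<in>closure (half_space k). u x = profile f M (x $ k)"
proof -
  note i = solution_imp_integrable[OF f u]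
  have uC2: "C2_on (half_space k) u" and uc: "continuous_on (closure (half_space k)) u"
    and upos: "\<And>x. x \<in> half_space k \<Longrightarrow> u x > 0"
    and ulap: "\<And>x. x \<in> half_space k \<Longrightarrow> laplacian u x = - f (u x)"
    and u0: "\<And>x. x \<in> frontier (half_space k) \<Longrightarrow> u x = 0"
    using u unfolding is_solution_def by force+
  have Hne: "half_space k \<noteq> ({} :: (real ^ 'n) set)"
  proof -
    have "axis k 1 \<in> half_space k" by (simp add: half_space_def)
    then show ?thesis by blast
  qed
  have xk: "x $ k > 0" if "x \<in> half_space k" for x using that by (simp add: half_space_def)
  define Q where "Q = (\<lambda>x. u x / x $ k) ` half_space k"
  define c where "c = Inf Q"
  have Q: "Q \<noteq> {}" "bdd_below Q" "\<And>q. q \<in> Q \<Longrightarrow> q \<ge> 0"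
  proof -
    show Q0: "\<And>q. q \<in> Q \<Longrightarrow> q \<ge> 0" using upos xk by (fastforce simp: Q_def order_less_le)
    show "bdd_below Q" using Q0 by (rule bdd_belowI)
    show "Q \<noteq> {}" using Hne by (simp add: Q_def)
  qed
  have c0: "c \<ge> 0" unfolding c_def using Q by (intro cInf_greatest) auto
  have lin: "c * x $ k \<le> u x" if "x \<in> half_space k" for x
  proof -
    have "c \<le> u x / x $ k" unfolding c_def using that Q by (intro cInf_lower) (auto simp: Q_def)
    then show ?thesis using xk[OF that] by (simp add: pos_le_divide_eq)
  qed
  \<comment> \<open>Gives the profile the slope \<open>sqrt (2 * M) = c\<close> at infinity. It then
    lies between \<open>c * x $ k\<close> and \<open>u\<close>, which is
    \<open>0 \<le> p \<le> P\<close> for the functions \<open>p\<close> and \<open>P\<close>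
    below.\<close>
  define M where "M = c\<^sup>2 / 2"
  have M: "M \<ge> 0" "sqrt (2 * M) = c" using c0 by (simp_all add: M_def)
  define v where "v = profile f M"
  note v = C2_on_profile[OF f i M(1), where k = k, folded v_def]
  have vu: "v (x $ k) \<le> u x" if "x \<in> closure (half_space k)" for x
    unfolding v_def by (rule profile_le_solution[OF f(1) u f i M(1)]) (use lin M(2) that in auto)
  have cv: "c * x $ k \<le> v (x $ k)" if "x \<in> closure (half_space k)" for x
    using profile_ge_linear[OF f i M(1), of "x $ k"] that M(2) by (simp add: v_def closure_half_space)
  define p where "p = (\<lambda>x. 1 * u x + (- 1) * v (x $ k))"
  define P where "P = (\<lambda>x. 1 * u x + (- c) * x $ k)"
  note p2 = C2_on_lincomb[OF open_half_space uC2 v(1), where a = 1 and b = "- 1", folded p_def]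
  have l: "C2_on (half_space k) (\<lambda>x. x $ k)"
    "\<And>x. x \<in> half_space k \<Longrightarrow> laplacian (\<lambda>x. x $ k) x = 0"
    using C2_on_coordinate[OF open_half_space, where h = "\<lambda>t. t" and h' = "\<lambda>_. 1" and h'' = "\<lambda>_. 0" and k = k] by auto
  note P2 = C2_on_lincomb[OF open_half_space uC2 l(1), where a = 1 and b = "- c", folded P_def]
  have "p x = 0" if x: "x \<in> half_space k" for x
  proof (rule sub_super_liouville_half_space[where p = p and P = P, OF p2(1) _ _ _ _ P2(1) _ _ _ _ _ x])
    show "continuous_on (closure (half_space k)) p" "continuous_on (closure (half_space k)) P"
      unfolding p_def P_def by (intro continuous_intros uc v(3))+
    show "0 \<le> laplacian p y" if "y \<in> half_space k" for y
    proof -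
      have "f (u y) \<le> f (v (y $ k))"
        using vu[of y] closure_subset[of "half_space k"] that upos v(4)
        by (intro monotone_onD[OF f(1)]) auto
      then show ?thesis using p2(2) ulap v(2) that by simp
    qed
    show "laplacian P y \<le> 0" if "y \<in> half_space k" for y
      using P2(2)[OF that] ulap[OF that] l(2)[OF that] f(2)[rule_format, OF upos[OF that]] by simp
    show "0 \<le> p y" if "y \<in> closure (half_space k)" for y using vu[OF that] by (simp add: p_def)
    show "p y = 0" if "y \<in> frontier (half_space k)" for y using u0[OF that] v(6)[OF that] by (simp add: p_def)
    show "0 \<le> P y" if "y \<in> closure (half_space k)" for y using vu[OF that] cv[OF that] by (simp add: P_def)
    show "p y \<le> P y" if "y \<in> half_space k" for y
      using cv[of y] closure_subset[of "half_space k"] that by (auto simp: p_def P_def)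
    show "\<exists>y\<in>half_space k. P y < \<epsilon> * y $ k" if "\<epsilon> > 0" for \<epsilon>
    proof -
      have "Inf Q < c + \<epsilon>" using that by (simp add: c_def)
      from cInf_lessD[OF Q(1) this] obtain y where y: "y \<in> half_space k" "u y / y $ k < c + \<epsilon>"
        by (auto simp: Q_def)
      then have "P y < \<epsilon> * y $ k" using xk[OF y(1)] by (simp add: P_def pos_divide_less_eq algebra_simps)
      with y(1) show ?thesis by blast
    qed
  qed
  then have "u x = v (x $ k)" if "x \<in> closure (half_space k)" for x
    using that u0[of x] v(6)[of x] by (cases "x \<in> half_space k")
      (auto simp: p_def frontier_def interior_open[OF open_half_space])
  then show ?thesis using M(1) unfolding v_def by blast
qed

lemma locally_lipschitz_on_imp_continuous_on:
  assumes "open S" "locally_lipschitz_on S f"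
  shows "continuous_on S f"
proof (rule continuous_at_imp_continuous_on, rule ballI)
  fix x assume x: "x \<in> S"
  with assms(2) obtain e L where e: "e > 0" "L-lipschitz_on (ball x e \<inter> S) f"
    unfolding locally_lipschitz_on_def by blast
  then have "continuous_on (ball x e \<inter> S) f" by (blast intro: lipschitz_on_continuous_on)
  moreover have "open (ball x e \<inter> S)" "x \<in> ball x e \<inter> S" using assms(1) e x by auto
  ultimately show "isCont f x" by (simp add: continuous_on_eq_continuous_at)
qed

theorem theorem4:
  fixes f :: "real \<Rightarrow> real" and k :: "'n::finite"
  assumes "antimono_on {0<..} f"
    and "\<And>t. t > 0 \<Longrightarrow> f t > 0"
    and "locally_lipschitz_on {0<..} f"
  shows "(\<forall>u :: real ^ 'n \<Rightarrow> real. is_solution f k u \<longrightarrow>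
            (\<forall>x\<in>closure (half_space k). \<forall>y\<in>closure (half_space k). x $ k = y $ k \<longrightarrow> u x = u y))
       \<and> ((\<exists>u :: real ^ 'n \<Rightarrow> real. is_solution f k u) \<longleftrightarrow>
            (\<integral>\<^sup>+t\<in>{1..}. ennreal (f t) \<partial>lborel) < \<infinity>)
       \<and> (\<forall>u :: real ^ 'n \<Rightarrow> real. is_solution f k u \<longrightarrow>
            (\<exists>M\<ge>0. \<exists>v. determined_by_formula f M v \<and>
               (\<forall>x\<in>closure (half_space k). u x = v (x $ k))))"
proof -
  have "continuous_on {0<..} f"
    by (rule locally_lipschitz_on_imp_continuous_on[OF _ assms(3)]) simp
  moreover have "\<forall>t>0. f t > 0" using assms(2) by blast
  ultimately have f: "antimono_on {0<..} f" "\<forall>t>0. f t > 0" "continuous_on {0<..} f"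
    using assms(1) by blast+
  have "continuous_on {1..} f" by (rule continuous_on_subset[OF f(3)]) auto
  then have iff: "(\<integral>\<^sup>+t\<in>{1..}. ennreal (f t) \<partial>lborel) < \<infinity> \<longleftrightarrow> set_integrable lborel {1..} f"
    by (rule integrable_on_Ici_iff(2)) (use f(2) in \<open>simp add: order_less_le\<close>)
  \<comment> \<open>\<open>M = 0\<close> is one choice of witness; every \<open>M \<ge> 0\<close>
    yields a solution in this way.\<close>
  have "is_solution f k (\<lambda>x. profile f 0 (x $ k))" if "set_integrable lborel {1..} f"
    using C2_on_profile[OF f that, where M = 0 and k = k] by (simp add: is_solution_def)
  then have ex: "(\<exists>u :: real ^ 'n \<Rightarrow> real. is_solution f k u) \<longleftrightarrow> set_integrable lborel {1..} f"
    using solution_imp_integrable[OF f] by blast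
  have eq: "\<exists>M\<ge>0. \<exists>v. determined_by_formula f M v \<and> (\<forall>x\<in>closure (half_space k). u x = v (x $ k))"
    if u: "is_solution f k u" for u :: "real ^ 'n \<Rightarrow> real"
    using solution_eq_profile[OF f u] determined_by_formula_profile[OF f solution_imp_integrable[OF f u]] by blast
  show ?thesis unfolding ex iff using eq by metis
qed

end
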